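(* Let $G$ be a group acting translatively on a simplicial poset $P$, and let $\mathbf k$ be a field. Then there is a ring isomorphism $$\mathcal R(P)^G\cong\mathcal R(P/G)$$ between the ring of $G$-invariants of the Stanley--Reisner ring of $P$ over $\mathbf k$ and the Stanley--Reisner ring of the quotient poset $P/G$ over $\mathbf k$.
   Context: A simplicial poset is a countable poset $P$ of finite length with a unique minimal element $\hat 0$ such that for every $p\in P$ the lower interval $P_{\leq p}=\{x\in P\mid x\le p\}$ is a (finite) Boolean algebra. $A(P)$ denotes the set of atoms of $P$ and $\max(P)$ the set of maximal elements. An action of $G$ on $P$ is a homomorphism from $G$ to the group of order automorphisms of $P$. It is translative if, for all $p\in P$, $g\in G$, whenever $\{p,gp\}$ has an upper bound in $P$ then $p=gp$. $P/G$ is the set of orbits ordered by $Gp\leq Gq$ iff $gp\leq q$ for some $g\in G$; for a translative action on a simplicial poset, $P/G$ is again a simplicial poset. Definition of $\mathcal R(P)$. If $\mathfrak a$ is a nonempty lower order ideal of $P$ contained in some $P_{\leq p}$, then $\mathfrak a$ is the face poset of a simplicial complex with vertex set $A(P)\cap\mathfrak a$. Its Stanley--Reisner ring is $R_{\mathfrak a}=\mathbf k[x_v\mid v\in A(P)\cap \mathfrak a]/(\prod_{v\in\sigma}x_v \mid \sigma\subseteq A(P)\cap\mathfrak a$ is not the set of atoms below an element of $\mathfrak a)$. For nonempty $\tau\subseteq\max(P)$ put $\lceil\tau\rceil=\bigcap_{t\in\tau}P_{\leq t}$, and let $X(P)=\{\lceil\tau\rceil\mid \emptyset\neq\tau\subseteq\max(P)\}$.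 For $\mathfrak a\supseteq\mathfrak b$ in $X(P)$ let $\pi^{\mathfrak a}_{\mathfrak b}:R_{\mathfrak a}\to R_{\mathfrak b}$ be the natural projection. Then $\mathcal R(P)$ is the ring of all tuples $(q_{\mathfrak a})_{\mathfrak a\in X(P)}$ with $q_{\mathfrak a}\in R_{\mathfrak a}$ and $\pi^{\mathfrak a}_{\mathfrak b}(q_{\mathfrak a})=q_{\mathfrak b}$ whenever $\mathfrak a\supseteq\mathfrak b$, with componentwise operations. Induced action. For $g\in G$ and $\mathfrak a\in X(P)$, the map $x_v\mapsto x_{gv}$ induces a ring isomorphism $\omega^g:R_{\mathfrak a}\to R_{g\mathfrak a}$. The group $G$ acts on $\mathcal R(P)$ by ring automorphisms via $(gq)_{\mathfrak a}=\omega^g(q_{g^{-1}\mathfrak a})$, and $\mathcal R(P)^G$ is the subring of elements $q$ with $gq=q$ for all $g\in G$. *)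

theory Defs
  imports
    "HOL-Algebra.QuotRing"
    "HOL-Algebra.Group_Action"
    "HOL-Algebra.Lattice"
    "HOL-Library.Countable_Set"
    "HOL-Library.Poly_Mapping"
begin

section \<open>Simplicial posets\<close>

definition minimals :: "('p, 'm) gorder_scheme \<Rightarrow> 'p set" where
  "minimals P = {x \<in> carrier P. \<forall>y\<in>carrier P. y \<sqsubseteq>\<^bsub>P\<^esub> x \<longrightarrow> y = x}"

definition maximals :: "('p, 'm) gorder_scheme \<Rightarrow> 'p set" where
  "maximals P = {x \<in> carrier P. \<forall>y\<in>carrier P. x \<sqsubseteq>\<^bsub>P\<^esub> y \<longrightarrow> y = x}"

definition below :: "('p, 'm) gorder_scheme \<Rightarrow> 'p \<Rightarrow> 'p set" where
  "below P p = {x \<in> carrier P. x \<sqsubseteq>\<^bsub>P\<^esub> p}"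

definition finite_length :: "('p, 'm) gorder_scheme \<Rightarrow> bool" where
  "finite_length P \<longleftrightarrow>
    (\<exists>n::nat. \<forall>C \<subseteq> carrier P. (\<forall>x\<in>C. \<forall>y\<in>C. x \<sqsubseteq>\<^bsub>P\<^esub> y \<or> y \<sqsubseteq>\<^bsub>P\<^esub> x)
        \<longrightarrow> finite C \<and> card C \<le> n)"

definition boolean_lattice :: "('p, 'm) gorder_scheme \<Rightarrow> bool" where
  "boolean_lattice L \<longleftrightarrow> bounded_lattice L \<and>
    (\<forall>x\<in>carrier L. \<forall>y\<in>carrier L. \<forall>z\<in>carrier L.
       x \<sqinter>\<^bsub>L\<^esub> (y \<squnion>\<^bsub>L\<^esub> z) = (x \<sqinter>\<^bsub>L\<^esub> y) \<squnion>\<^bsub>L\<^esub> (x \<sqinter>\<^bsub>L\<^esub> z)) \<and>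
    (\<forall>x\<in>carrier L. \<exists>y\<in>carrier L. x \<sqinter>\<^bsub>L\<^esub> y = \<bottom>\<^bsub>L\<^esub> \<and> x \<squnion>\<^bsub>L\<^esub> y = \<top>\<^bsub>L\<^esub>)"

definition simplicial_poset :: "('p, 'm) gorder_scheme \<Rightarrow> bool" where
  "simplicial_poset P \<longleftrightarrow> partial_order P \<and> countable (carrier P) \<and> finite_length P \<and>
    (\<exists>!z. z \<in> minimals P) \<and>
    (\<forall>p\<in>carrier P. finite (below P p) \<and> boolean_lattice (P\<lparr>carrier := below P p\<rparr>))"

definition zero_hat :: "('p, 'm) gorder_scheme \<Rightarrow> 'p" where
  "zero_hat P = (THE z. z \<in> minimals P)"

definition atoms :: "('p, 'm) gorder_scheme \<Rightarrow> 'p set" where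
  "atoms P = {v \<in> carrier P. v \<noteq> zero_hat P \<and>
    (\<forall>y\<in>carrier P. y \<sqsubseteq>\<^bsub>P\<^esub> v \<longrightarrow> y = zero_hat P \<or> y = v)}"


section \<open>Translative actions and quotient posets\<close>

definition poset_action ::
    "('g, 'n) monoid_scheme \<Rightarrow> ('p, 'm) gorder_scheme \<Rightarrow> ('g \<Rightarrow> 'p \<Rightarrow> 'p) \<Rightarrow> bool" where
  "poset_action G P \<phi> \<longleftrightarrow> group_action G (carrier P) \<phi> \<and>
    (\<forall>g\<in>carrier G. \<forall>x\<in>carrier P. \<forall>y\<in>carrier P. \<phi> g x \<sqsubseteq>\<^bsub>P\<^esub> \<phi> g y \<longleftrightarrow> x \<sqsubseteq>\<^bsub>P\<^esub> y)"

definition translative ::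
    "('g, 'n) monoid_scheme \<Rightarrow> ('p, 'm) gorder_scheme \<Rightarrow> ('g \<Rightarrow> 'p \<Rightarrow> 'p) \<Rightarrow> bool" where
  "translative G P \<phi> \<longleftrightarrow>
    (\<forall>p\<in>carrier P. \<forall>g\<in>carrier G.
       (\<exists>u\<in>carrier P. p \<sqsubseteq>\<^bsub>P\<^esub> u \<and> \<phi> g p \<sqsubseteq>\<^bsub>P\<^esub> u) \<longrightarrow> p = \<phi> g p)"

definition quotient_poset ::
    "('g, 'n) monoid_scheme \<Rightarrow> ('p, 'm) gorder_scheme \<Rightarrow> ('g \<Rightarrow> 'p \<Rightarrow> 'p) \<Rightarrow> 'p set gorder" where
  "quotient_poset G P \<phi> =
    \<lparr>carrier = orbits G (carrier P) \<phi>, eq = (=),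
     le = (\<lambda>A B. \<exists>p\<in>A. \<exists>q\<in>B. \<exists>g\<in>carrier G. \<phi> g p \<sqsubseteq>\<^bsub>P\<^esub> q)\<rparr>"


section \<open>Polynomial rings\<close>

text \<open>A monomial is a finitely supported exponent vector \<open>'v \<Rightarrow>\<^sub>0 nat\<close>, a polynomial a finitely
  supported family of coefficients indexed by monomials; multiplication of \<^typ>\<open>('v \<Rightarrow>\<^sub>0 nat) \<Rightarrow>\<^sub>0 'k\<close>
  is convolution.\<close>

type_synonym ('v, 'k) mpoly = "('v \<Rightarrow>\<^sub>0 nat) \<Rightarrow>\<^sub>0 'k"

definition mvar :: "'v \<Rightarrow> ('v, 'k::field) mpoly" where
  "mvar v = Poly_Mapping.single (Poly_Mapping.single v 1) 1"

definition mconst :: "'k::field \<Rightarrow> ('v, 'k) mpoly" where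
  "mconst c = Poly_Mapping.single 0 c"

definition poly_ring :: "'k::field itself \<Rightarrow> 'v set \<Rightarrow> ('v, 'k) mpoly ring" where
  "poly_ring k V =
    \<lparr>carrier = {p. \<forall>m\<in>Poly_Mapping.keys p. Poly_Mapping.keys m \<subseteq> V},
     mult = (*), one = 1, zero = 0, add = (+)\<rparr>"

text \<open>The \<open>\<^bold>k\<close>-algebra homomorphism with \<open>x\<^sub>v \<mapsto> f v\<close>.\<close>

definition poly_subst :: "('v \<Rightarrow> ('w, 'k::field) mpoly) \<Rightarrow> ('v, 'k) mpoly \<Rightarrow> ('w, 'k) mpoly" where
  "poly_subst f p =
    (\<Sum>m\<in>Poly_Mapping.keys p.
       mconst (Poly_Mapping.lookup p m) * (\<Prod>v\<in>Poly_Mapping.keys m. f v ^ Poly_Mapping.lookup m v))"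

text \<open>The map \<open>R/I \<rightarrow> S/J\<close> induced by a homomorphism \<open>h : R \<rightarrow> S\<close> with \<open>h(I) \<subseteq> J\<close>; then the set
  below is a singleton for each coset \<open>C\<close> of \<open>I\<close>.\<close>

definition quot_map :: "('b, 'm) ring_scheme \<Rightarrow> 'b set \<Rightarrow> ('a \<Rightarrow> 'b) \<Rightarrow> 'a set \<Rightarrow> 'b set" where
  "quot_map S J h C = the_elem ((\<lambda>p. J +>\<^bsub>S\<^esub> h p) ` C)"


section \<open>Stanley--Reisner rings of ideals contained in a lower interval\<close>

definition face_sets :: "('p, 'm) gorder_scheme \<Rightarrow> 'p set \<Rightarrow> 'p set set" where
  "face_sets P \<aa> = {{v \<in> atoms P. v \<sqsubseteq>\<^bsub>P\<^esub> x} | x. x \<in> \<aa>}"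

definition local_poly_ring ::
    "'k::field itself \<Rightarrow> ('p, 'm) gorder_scheme \<Rightarrow> 'p set \<Rightarrow> ('p, 'k) mpoly ring" where
  "local_poly_ring k P \<aa> = poly_ring k (atoms P \<inter> \<aa>)"

definition local_SR_ideal ::
    "'k::field itself \<Rightarrow> ('p, 'm) gorder_scheme \<Rightarrow> 'p set \<Rightarrow> ('p, 'k) mpoly set" where
  "local_SR_ideal k P \<aa> =
    Idl\<^bsub>local_poly_ring k P \<aa>\<^esub> {\<Prod>v\<in>\<sigma>. mvar v | \<sigma>. \<sigma> \<subseteq> atoms P \<inter> \<aa> \<and> \<sigma> \<notin> face_sets P \<aa>}"

definition local_SR_ring ::
    "'k::field itself \<Rightarrow> ('p, 'm) gorder_scheme \<Rightarrow> 'p set \<Rightarrow> ('p, 'k) mpoly set ring" where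
  "local_SR_ring k P \<aa> = local_poly_ring k P \<aa> Quot local_SR_ideal k P \<aa>"

text \<open>The projection \<open>R\<^sub>\<aa> \<rightarrow> R\<^sub>\<bb>\<close> for \<open>\<bb> \<subseteq> \<aa>\<close>: variables outside \<open>\<bb>\<close> are set to zero. The
  source \<open>\<aa>\<close> enters only through the argument coset.\<close>

definition SR_proj ::
    "'k::field itself \<Rightarrow> ('p, 'm) gorder_scheme \<Rightarrow> 'p set \<Rightarrow> ('p, 'k) mpoly set \<Rightarrow> ('p, 'k) mpoly set" where
  "SR_proj k P \<bb> = quot_map (local_poly_ring k P \<bb>) (local_SR_ideal k P \<bb>)
     (poly_subst (\<lambda>v. if v \<in> \<bb> then mvar v else 0))"

text \<open>The isomorphism \<open>\<omega>\<^sup>g : R\<^sub>\<aa> \<rightarrow> R\<^sub>g\<^sub>\<aa>\<close>, \<open>x\<^sub>v \<mapsto> x\<^sub>g\<^sub>v\<close>.\<close>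

definition SR_omega ::
    "'k::field itself \<Rightarrow> ('p, 'm) gorder_scheme \<Rightarrow> ('g \<Rightarrow> 'p \<Rightarrow> 'p) \<Rightarrow> 'g \<Rightarrow> 'p set
      \<Rightarrow> ('p, 'k) mpoly set \<Rightarrow> ('p, 'k) mpoly set" where
  "SR_omega k P \<phi> g \<aa> =
     quot_map (local_poly_ring k P (\<phi> g ` \<aa>)) (local_SR_ideal k P (\<phi> g ` \<aa>))
       (poly_subst (\<lambda>v. mvar (\<phi> g v)))"


section \<open>The Stanley--Reisner ring of a simplicial poset and its invariants\<close>

definition max_meets :: "('p, 'm) gorder_scheme \<Rightarrow> 'p set set" where
  "max_meets P = {\<Inter>t\<in>\<tau>. below P t | \<tau>. \<tau> \<noteq> {} \<and> \<tau> \<subseteq> maximals P}"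

definition SR_ring ::
    "'k::field itself \<Rightarrow> ('p, 'm) gorder_scheme \<Rightarrow> ('p set \<Rightarrow> ('p, 'k) mpoly set) ring" where
  "SR_ring k P =
    \<lparr>carrier = {q \<in> (\<Pi>\<^sub>E \<aa>\<in>max_meets P. carrier (local_SR_ring k P \<aa>)).
        \<forall>\<aa>\<in>max_meets P. \<forall>\<bb>\<in>max_meets P. \<bb> \<subseteq> \<aa> \<longrightarrow> SR_proj k P \<bb> (q \<aa>) = q \<bb>},
     mult = (\<lambda>q r. \<lambda>\<aa>\<in>max_meets P. q \<aa> \<otimes>\<^bsub>local_SR_ring k P \<aa>\<^esub> r \<aa>),
     one = (\<lambda>\<aa>\<in>max_meets P. \<one>\<^bsub>local_SR_ring k P \<aa>\<^esub>),
     zero = (\<lambda>\<aa>\<in>max_meets P. \<zero>\<^bsub>local_SR_ring k P \<aa>\<^esub>),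
     add = (\<lambda>q r. \<lambda>\<aa>\<in>max_meets P. q \<aa> \<oplus>\<^bsub>local_SR_ring k P \<aa>\<^esub> r \<aa>)\<rparr>"

definition SR_action ::
    "'k::field itself \<Rightarrow> ('g, 'n) monoid_scheme \<Rightarrow> ('p, 'm) gorder_scheme \<Rightarrow> ('g \<Rightarrow> 'p \<Rightarrow> 'p)
      \<Rightarrow> 'g \<Rightarrow> ('p set \<Rightarrow> ('p, 'k) mpoly set) \<Rightarrow> ('p set \<Rightarrow> ('p, 'k) mpoly set)" where
  "SR_action k G P \<phi> g q =
    (\<lambda>\<aa>\<in>max_meets P.
       SR_omega k P \<phi> g (\<phi> (inv\<^bsub>G\<^esub> g) ` \<aa>) (q (\<phi> (inv\<^bsub>G\<^esub> g) ` \<aa>)))"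

definition SR_invariant_ring ::
    "'k::field itself \<Rightarrow> ('g, 'n) monoid_scheme \<Rightarrow> ('p, 'm) gorder_scheme \<Rightarrow> ('g \<Rightarrow> 'p \<Rightarrow> 'p)
      \<Rightarrow> ('p set \<Rightarrow> ('p, 'k) mpoly set) ring" where
  "SR_invariant_ring k G P \<phi> =
    (SR_ring k P)\<lparr>carrier :=
       {q \<in> carrier (SR_ring k P). \<forall>g\<in>carrier G. SR_action k G P \<phi> g q = q}\<rparr>"

end

theory Submission
  imports Defs
begin

text \<open>
  Below a maximal element \<open>t\<close> every set of atoms is a face, so the Stanley--Reisner ideal of the lower
  interval of \<open>t\<close> is zero and its local ring is the polynomial ring in the atoms below \<open>t\<close>. All the
  other local rings receive surjections from these. Hence an element of \<open>R(P)\<close> is the same as a family of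
  polynomials \<open>f\<^sub>t\<close>, one for each maximal \<open>t\<close>, such that \<open>f\<^sub>t\<close> and \<open>f\<^sub>u\<close> have equal coefficients at
  the monomials whose support is the set of atoms below a common lower bound of \<open>t\<close> and \<open>u\<close>; it is
  invariant iff \<open>f\<^bsub>gt\<^esub>\<close> is obtained from \<open>f\<^sub>t\<close> by \<open>x\<^sub>v \<mapsto> x\<^bsub>gv\<^esub>\<close>.
  For a translative action the orbit map is an isomorphism from each lower interval of \<open>P\<close> onto one of
  \<open>P/G\<close>. Replacing every variable \<open>x\<^sub>v\<close> by the variable of the orbit of \<open>v\<close> therefore turns the
  equivariant families on \<open>P\<close> into the families on \<open>P/G\<close>, bijectively.
\<close>

section \<open>Substitution in polynomials\<close>

text \<open>The obstacle is that the index sets of the two inverse limits do not correspond. For the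
  orbits of t and u, the intersection of their lower intervals in P/G is the union, over all g, of
  the images of the intersections of the intervals of t and gu in P. So an element of
  \<open>max_meets Q\<close> is in general not the image of an element of
  \<open>max_meets P\<close>, and there is no evident componentwise comparison. Families over the
  maximal elements avoid this: their compatibility is tested at one common lower bound x at a time,
  and a single x can be lifted to P, after which the group moves the two maximal elements above it.
  Testing at elements rather than at monomials matters, since distinct elements of a simplicial
  poset may have the same atoms. The reduction to families is applied to P and to P/G; it is
  therefore proved in \<open>face_poset\<close> from a few properties that pass to the quotient
  through the orbit map.\<close>

lemma poly_mapping_sum_single:
  "p = (\<Sum>m\<in>Poly_Mapping.keys p. Poly_Mapping.single m (Poly_Mapping.lookup p m))"
  by (rule poly_mapping_eqI)
    (auto simp: lookup_sum lookup_single when_def in_keys_iff sum.delta' if_distrib cong: if_cong)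

section \<open>Renaming of variables in monomials\<close>

definition rename_monom :: "('v \<Rightarrow> 'w) \<Rightarrow> ('v \<Rightarrow>\<^sub>0 nat) \<Rightarrow> ('w \<Rightarrow>\<^sub>0 nat)" where
  "rename_monom h m =
     (\<Sum>v\<in>Poly_Mapping.keys m. Poly_Mapping.single (h v) (Poly_Mapping.lookup m v))"

text \<open>The supports of m, n and m + n differ; a finite index set containing all of them turns
  additivity into a termwise identity. The same device serves \<open>eval_monom\<close> and
  \<open>poly_subst\<close>.\<close>

lemma rename_monom_superset:
  assumes "finite S" "Poly_Mapping.keys m \<subseteq> S"
  shows "rename_monom h m = (\<Sum>v\<in>S. Poly_Mapping.single (h v) (Poly_Mapping.lookup m v))"
  unfolding rename_monom_def
  by (rule sum.mono_neutral_left) (use assms in \<open>auto simp: in_keys_iff\<close>)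

lemma rename_monom_single: "rename_monom h (Poly_Mapping.single v n) = Poly_Mapping.single (h v) n"
  by (simp add: rename_monom_def)

lemma rename_monom_add: "rename_monom h (m + n) = rename_monom h m + rename_monom h n"
proof -
  let ?S = "Poly_Mapping.keys m \<union> Poly_Mapping.keys n"
  have "Poly_Mapping.keys (m + n) \<subseteq> ?S" by (rule Poly_Mapping.keys_add)
  then show ?thesis
    by (simp add: rename_monom_superset[of ?S] lookup_add single_add sum.distrib)
qed

lemma rename_monom_sum: "rename_monom h (\<Sum>i\<in>I. a i) = (\<Sum>i\<in>I. rename_monom h (a i))"
  by (induction I rule: infinite_finite_induct)
    (auto simp: rename_monom_add, auto simp: rename_monom_def)

lemma rename_monom_compose: "rename_monom g (rename_monom h m) = rename_monom (\<lambda>v. g (h v)) m"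
  unfolding rename_monom_def[of h] rename_monom_sum rename_monom_single
  by (simp add: rename_monom_def)

lemma rename_monom_id:
  assumes "\<And>v. v \<in> Poly_Mapping.keys m \<Longrightarrow> h v = v"
  shows "rename_monom h m = m"
  using poly_mapping_sum_single[of m] assms by (simp add: rename_monom_def)

text \<open>Exponents are natural numbers, so the contributions of variables with the same image add
  up without cancelling.\<close>

lemma keys_rename_monom: "Poly_Mapping.keys (rename_monom h m) = h ` Poly_Mapping.keys m"
proof -
  have "w \<in> Poly_Mapping.keys (rename_monom h m) \<longleftrightarrow>
      w \<in> h ` Poly_Mapping.keys m" for w
    unfolding rename_monom_def in_keys_iff lookup_sum lookup_single when_def
    by (subst sum_eq_0_iff) (auto simp: in_keys_iff)
  then show ?thesis by blast
qed

lemma inj_on_rename_monom: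
  assumes "inj_on h V"
  shows "inj_on (rename_monom h) {m. Poly_Mapping.keys m \<subseteq> V}"
  by (rule inj_on_inverseI[where g = "rename_monom (inv_into V h)"])
    (use assms in \<open>auto simp: rename_monom_compose intro!: rename_monom_id\<close>)

section \<open>Substitution as a ring homomorphism\<close>

definition eval_monom :: "('v \<Rightarrow> 'a::comm_semiring_1) \<Rightarrow> ('v \<Rightarrow>\<^sub>0 nat) \<Rightarrow> 'a" where
  "eval_monom f m = (\<Prod>v\<in>Poly_Mapping.keys m. f v ^ Poly_Mapping.lookup m v)"

lemma eval_monom_superset:
  assumes "finite S" "Poly_Mapping.keys m \<subseteq> S"
  shows "eval_monom f m = (\<Prod>v\<in>S. f v ^ Poly_Mapping.lookup m v)"
  unfolding eval_monom_def
  by (rule prod.mono_neutral_left) (use assms in \<open>auto simp: in_keys_iff\<close>)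

lemma eval_monom_0 [simp]: "eval_monom f 0 = 1"
  by (simp add: eval_monom_def)

lemma eval_monom_add: "eval_monom f (m + n) = eval_monom f m * eval_monom f n"
proof -
  let ?S = "Poly_Mapping.keys m \<union> Poly_Mapping.keys n"
  have "Poly_Mapping.keys (m + n) \<subseteq> ?S" by (rule Poly_Mapping.keys_add)
  then show ?thesis
    by (simp add: eval_monom_superset[of ?S] lookup_add power_add prod.distrib)
qed

lemma poly_subst_superset:
  assumes "finite S" "Poly_Mapping.keys p \<subseteq> S"
  shows "poly_subst f p = (\<Sum>m\<in>S. mconst (Poly_Mapping.lookup p m) * eval_monom f m)"
  unfolding poly_subst_def eval_monom_def
  by (rule sum.mono_neutral_left) (use assms in \<open>auto simp: in_keys_iff mconst_def\<close>)

lemma poly_subst_single: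
  "poly_subst f (Poly_Mapping.single m c) = mconst c * eval_monom f m"
  by (simp add: poly_subst_def eval_monom_def mconst_def)

lemma poly_subst_add: "poly_subst f (p + q) = poly_subst f p + poly_subst f q"
proof -
  let ?S = "Poly_Mapping.keys p \<union> Poly_Mapping.keys q"
  have "Poly_Mapping.keys (p + q) \<subseteq> ?S" by (rule Poly_Mapping.keys_add)
  then show ?thesis
    by (simp add: poly_subst_superset[of ?S] mconst_def lookup_add single_add sum.distrib
        distrib_right)
qed

lemma poly_subst_sum: "poly_subst f (\<Sum>i\<in>I. a i) = (\<Sum>i\<in>I. poly_subst f (a i))"
  by (induction I rule: infinite_finite_induct)
    (auto simp: poly_subst_add, auto simp: poly_subst_def)

lemma poly_subst_one: "poly_subst f 1 = 1"
  using poly_subst_single[of f 0 1] by (simp add: mconst_def)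

text \<open>Both sides are additive in p and in q, so the identity need only be checked on single
  terms, where it is \<open>eval_monom_add\<close>.\<close>

lemma poly_subst_mult: "poly_subst f (p * q) = poly_subst f p * poly_subst f q"
proof -
  have s: "poly_subst f (Poly_Mapping.single m c * Poly_Mapping.single n d) =
      poly_subst f (Poly_Mapping.single m c) * poly_subst f (Poly_Mapping.single n d)" for m n c d
  proof -
    have "poly_subst f (Poly_Mapping.single m c * Poly_Mapping.single n d) =
        mconst c * mconst d * (eval_monom f m * eval_monom f n)"
      by (simp add: mult_single poly_subst_single eval_monom_add mconst_def)
    then show ?thesis by (simp add: poly_subst_single ac_simps)
  qed
  have "poly_subst f ((\<Sum>m\<in>Poly_Mapping.keys p. Poly_Mapping.single m (Poly_Mapping.lookup p m))
      * (\<Sum>m\<in>Poly_Mapping.keys q. Poly_Mapping.single m (Poly_Mapping.lookup q m)))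
    = poly_subst f (\<Sum>m\<in>Poly_Mapping.keys p. Poly_Mapping.single m (Poly_Mapping.lookup p m))
      * poly_subst f (\<Sum>m\<in>Poly_Mapping.keys q. Poly_Mapping.single m (Poly_Mapping.lookup q m))"
    by (simp add: sum_product poly_subst_sum s)
  then show ?thesis
    by (simp flip: poly_mapping_sum_single)
qed

lemma prod_single_one:
  "(\<Prod>i\<in>I. Poly_Mapping.single (a i) (1::'k::field)) = Poly_Mapping.single (\<Sum>i\<in>I. a i) 1"
  by (induction I rule: infinite_finite_induct) (auto simp: mult_single)

lemma mvar_power: "mvar v ^ n = Poly_Mapping.single (Poly_Mapping.single v n) (1::'k::field)"
  by (induction n) (auto simp: mvar_def mult_single simp flip: single_add)

lemma eval_monom_mvar:
  "eval_monom (\<lambda>v. mvar (h v)) m = Poly_Mapping.single (rename_monom h m) (1::'k::field)"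
  by (simp add: eval_monom_def mvar_power prod_single_one rename_monom_def)

section \<open>Renaming of variables in polynomials\<close>

definition rename_poly :: "('v \<Rightarrow> 'w) \<Rightarrow> ('v, 'k::field) mpoly \<Rightarrow> ('w, 'k) mpoly" where
  "rename_poly h = poly_subst (\<lambda>v. mvar (h v))"

lemma rename_poly_mult: "rename_poly h (p * q) = rename_poly h p * rename_poly h q"
  by (simp add: rename_poly_def poly_subst_mult)

lemma rename_poly_add: "rename_poly h (p + q) = rename_poly h p + rename_poly h q"
  by (simp add: rename_poly_def poly_subst_add)

lemma rename_poly_one: "rename_poly h 1 = 1"
  by (simp add: rename_poly_def poly_subst_one)

lemma rename_poly_single:
  "rename_poly h (Poly_Mapping.single m c) = Poly_Mapping.single (rename_monom h m) c"
  by (simp add: rename_poly_def poly_subst_single eval_monom_mvar mconst_def mult_single)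

lemma rename_poly_eq:
  "rename_poly h p =
     (\<Sum>m\<in>Poly_Mapping.keys p. Poly_Mapping.single (rename_monom h m) (Poly_Mapping.lookup p m))"
proof -
  have "rename_poly h (\<Sum>m\<in>Poly_Mapping.keys p. Poly_Mapping.single m (Poly_Mapping.lookup p m)) =
     (\<Sum>m\<in>Poly_Mapping.keys p. Poly_Mapping.single (rename_monom h m) (Poly_Mapping.lookup p m))"
    unfolding rename_poly_def poly_subst_sum by (simp flip: rename_poly_def add: rename_poly_single)
  then show ?thesis by (simp flip: poly_mapping_sum_single)
qed

lemma rename_poly_compose: "rename_poly g (rename_poly h p) = rename_poly (\<lambda>v. g (h v)) p"
proof -
  have "rename_poly g (rename_poly h p) = (\<Sum>m\<in>Poly_Mapping.keys p.
       rename_poly g (Poly_Mapping.single (rename_monom h m) (Poly_Mapping.lookup p m)))"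
    unfolding rename_poly_eq[of h] unfolding rename_poly_def poly_subst_sum ..
  then show ?thesis
    unfolding rename_poly_eq[of "\<lambda>v. g (h v)"] by (simp add: rename_poly_single rename_monom_compose)
qed

definition poly_vars :: "('v, 'k::zero) mpoly \<Rightarrow> 'v set" where
  "poly_vars p = (\<Union>m\<in>Poly_Mapping.keys p. Poly_Mapping.keys m)"

lemma rename_poly_cong:
  assumes "\<And>v. v \<in> poly_vars p \<Longrightarrow> g v = h v"
  shows "rename_poly g p = rename_poly h p"
proof -
  have "rename_monom g m = rename_monom h m" if "m \<in> Poly_Mapping.keys p" for m
    unfolding rename_monom_def using that assms
    by (intro sum.cong refl arg_cong2[where f = Poly_Mapping.single]) (auto simp: poly_vars_def)
  then show ?thesis by (simp add: rename_poly_eq)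
qed

lemma rename_poly_id:
  assumes "\<And>v. v \<in> poly_vars p \<Longrightarrow> h v = v"
  shows "rename_poly h p = p"
proof -
  have "rename_monom h m = m" if "m \<in> Poly_Mapping.keys p" for m
    using that assms by (intro rename_monom_id) (auto simp: poly_vars_def)
  then show ?thesis
    using poly_mapping_sum_single[of p] by (simp add: rename_poly_eq)
qed

text \<open>Only an inclusion: if h merges monomials, their coefficients may cancel.\<close>

lemma poly_vars_rename_poly: "poly_vars (rename_poly h p) \<subseteq> h ` poly_vars p"
proof -
  have "Poly_Mapping.keys (rename_poly h p) \<subseteq> rename_monom h ` Poly_Mapping.keys p"
    unfolding rename_poly_eq by (rule order_trans[OF keys_sum]) auto
  then show ?thesis
    unfolding poly_vars_def by (fastforce simp: keys_rename_monom)
qed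

text \<open>Injectivity on V carries over to the monomials in V, so the term of p at m is the only
  one in \<open>rename_poly_eq\<close> that can contribute to this coefficient.\<close>

lemma lookup_rename_poly:
  assumes "inj_on h V" "poly_vars p \<subseteq> V" "Poly_Mapping.keys m \<subseteq> V"
  shows "Poly_Mapping.lookup (rename_poly h p) (rename_monom h m) = Poly_Mapping.lookup p m"
proof -
  have "rename_monom h n = rename_monom h m \<longleftrightarrow> n = m" if "n \<in> Poly_Mapping.keys p" for n
    using inj_onD[OF inj_on_rename_monom[OF assms(1)], of n m] that assms(2,3)
    by (auto simp: poly_vars_def)
  then have "Poly_Mapping.lookup (rename_poly h p) (rename_monom h m) =
      (\<Sum>n\<in>Poly_Mapping.keys p. if n = m then Poly_Mapping.lookup p n else 0)"
    unfolding rename_poly_eq lookup_sum lookup_single when_def by (intro sum.cong) auto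
  then show ?thesis by (simp add: in_keys_iff)
qed

lemma poly_mapping_eqI_vars:
  assumes "poly_vars p \<subseteq> V" "poly_vars q \<subseteq> V"
    and "\<And>m. Poly_Mapping.keys m \<subseteq> V \<Longrightarrow> Poly_Mapping.lookup p m = Poly_Mapping.lookup q m"
  shows "p = q"
proof (rule poly_mapping_eqI)
  fix m
  show "Poly_Mapping.lookup p m = Poly_Mapping.lookup q m"
  proof (cases "Poly_Mapping.keys m \<subseteq> V")
    case False
    then have "m \<notin> Poly_Mapping.keys p" "m \<notin> Poly_Mapping.keys q"
      using assms(1,2) by (auto simp: poly_vars_def)
    then show ?thesis by (simp add: in_keys_iff)
  qed (rule assms(3))
qed

lemma inj_on_rename_poly:
  assumes "inj_on h V"
  shows "inj_on (rename_poly h) {p. poly_vars p \<subseteq> V}"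
  by (rule inj_onI, rule poly_mapping_eqI_vars[of _ V]) (auto simp flip: lookup_rename_poly[OF assms])

section \<open>Truncation to a set of variables\<close>

definition restrict_poly :: "'v set \<Rightarrow> ('v, 'k::field) mpoly \<Rightarrow> ('v, 'k) mpoly" where
  "restrict_poly B = poly_subst (\<lambda>v. if v \<in> B then mvar v else 0)"

lemma restrict_poly_mult: "restrict_poly B (p * q) = restrict_poly B p * restrict_poly B q"
  by (simp add: restrict_poly_def poly_subst_mult)

lemma restrict_poly_add: "restrict_poly B (p + q) = restrict_poly B p + restrict_poly B q"
  by (simp add: restrict_poly_def poly_subst_add)

lemma restrict_poly_one: "restrict_poly B 1 = 1"
  by (simp add: restrict_poly_def poly_subst_one)

text \<open>A monomial with all its variables in B is fixed by the substitution and every other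
  monomial is sent to zero; the projections thus act by deleting terms.\<close>

lemma lookup_restrict_poly:
  fixes p :: "('v, 'k::field) mpoly"
  shows "Poly_Mapping.lookup (restrict_poly B p) m =
    (if Poly_Mapping.keys m \<subseteq> B then Poly_Mapping.lookup p m else 0)"
proof -
  have e: "eval_monom (\<lambda>v. if v \<in> B then mvar v else 0) n =
      (if Poly_Mapping.keys n \<subseteq> B then Poly_Mapping.single n (1::'k) else 0)" for n :: "'v \<Rightarrow>\<^sub>0 nat"
  proof (cases "Poly_Mapping.keys n \<subseteq> B")
    case True
    then have "eval_monom (\<lambda>v. if v \<in> B then mvar v else 0) n = eval_monom (\<lambda>v. mvar v) n"
      unfolding eval_monom_def by (intro prod.cong) auto
    with True show ?thesis by (simp add: eval_monom_mvar rename_monom_id)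
  next
    case False
    then obtain v where "v \<in> Poly_Mapping.keys n" "v \<notin> B" by auto
    \<comment> \<open>The variable v occurs with positive exponent, so its factor is a positive
      power of 0.\<close>
    then have "\<exists>v\<in>Poly_Mapping.keys n.
        (if v \<in> B then mvar v else (0::('v, 'k) mpoly)) ^ Poly_Mapping.lookup n v = 0"
      by (intro bexI[of _ v]) (auto simp: in_keys_iff zero_power)
    then show ?thesis
      using False unfolding eval_monom_def by (auto intro: prod_zero)
  qed
  have r: "restrict_poly B p = (\<Sum>n\<in>Poly_Mapping.keys p.
      if Poly_Mapping.keys n \<subseteq> B then Poly_Mapping.single n (Poly_Mapping.lookup p n) else 0)"
    unfolding restrict_poly_def
    by (subst poly_subst_superset[of "Poly_Mapping.keys p"])
      (auto simp: e mconst_def mult_single intro!: sum.cong)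
  have "Poly_Mapping.lookup (restrict_poly B p) m = (\<Sum>n\<in>Poly_Mapping.keys p.
      if n = m then (if Poly_Mapping.keys m \<subseteq> B then Poly_Mapping.lookup p m else 0) else 0)"
    unfolding r lookup_sum by (intro sum.cong) (auto simp: lookup_single when_def)
  then show ?thesis by (auto simp: in_keys_iff)
qed

lemma poly_vars_restrict_poly: "poly_vars (restrict_poly B p) \<subseteq> B \<inter> poly_vars p"
  by (force simp: poly_vars_def in_keys_iff[of _ "restrict_poly B p"] in_keys_iff[of _ p]
      lookup_restrict_poly split: if_splits)

section \<open>Stanley--Reisner ideals\<close>

lemma carrier_poly_ring: "carrier (poly_ring k V) = {p. poly_vars p \<subseteq> V}"
  by (auto simp: poly_ring_def poly_vars_def)

lemma poly_ring_ops [simp]: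
  "x \<otimes>\<^bsub>poly_ring k V\<^esub> y = x * y" "x \<oplus>\<^bsub>poly_ring k V\<^esub> y = x + y"
  "\<one>\<^bsub>poly_ring k V\<^esub> = 1" "\<zero>\<^bsub>poly_ring k V\<^esub> = 0"
  by (simp_all add: poly_ring_def)

lemma poly_vars_0 [simp]: "poly_vars 0 = {}"
  by (simp add: poly_vars_def)

lemma poly_vars_1 [simp]: "poly_vars (1 :: ('v, 'k::zero_neq_one) mpoly) = {}"
  by (simp add: poly_vars_def)

lemma poly_vars_add: "poly_vars (p + q) \<subseteq> poly_vars p \<union> poly_vars q"
  using Poly_Mapping.keys_add[of p q] by (auto simp: poly_vars_def)

lemma poly_vars_diff: "poly_vars (p - q) \<subseteq> poly_vars p \<union> poly_vars (q :: ('v, 'k::ab_group_add) mpoly)"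
proof -
  have "Poly_Mapping.keys (p - q) \<subseteq> Poly_Mapping.keys p \<union> Poly_Mapping.keys q"
    by (auto simp: in_keys_iff lookup_minus)
  then show ?thesis by (auto simp: poly_vars_def)
qed

lemma keys_add_monom:
  "Poly_Mapping.keys (m + n) = Poly_Mapping.keys m \<union> Poly_Mapping.keys (n :: 'v \<Rightarrow>\<^sub>0 nat)"
  by (auto simp: in_keys_iff lookup_add)

lemma poly_vars_mult: "poly_vars (p * q) \<subseteq> poly_vars p \<union> poly_vars q"
  using keys_mult[of p q] unfolding poly_vars_def
  by (fastforce simp: keys_add_monom)

lemma cring_poly_ring: "cring (poly_ring k V)"
proof (rule cringI)
  show "abelian_group (poly_ring k V)"
  proof (rule abelian_groupI)
    fix x assume "x \<in> carrier (poly_ring k V)"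
    then show "\<exists>y\<in>carrier (poly_ring k V). y \<oplus>\<^bsub>poly_ring k V\<^esub> x = \<zero>\<^bsub>poly_ring k V\<^esub>"
      by (intro bexI[of _ "- x"])
        (auto simp: carrier_poly_ring poly_vars_def in_keys_iff)
  qed (use poly_vars_add in \<open>fastforce simp: carrier_poly_ring add.assoc add.commute\<close>)+
  show "comm_monoid (poly_ring k V)"
    by (rule comm_monoidI)
      (use poly_vars_mult in \<open>fastforce simp: carrier_poly_ring ac_simps\<close>)+
qed (simp add: distrib_right)

text \<open>The Stanley--Reisner ideal of a complex \<open>F\<close> on \<open>V\<close>, described
  by coefficients: no term is supported on a face. \<open>Idl_nonfaces\<close> identifies it with
  the ideal generated by the nonfaces.\<close>

definition face_free :: "'v set \<Rightarrow> 'v set set \<Rightarrow> ('v, 'k::field) mpoly set" where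
  "face_free V F = {p. poly_vars p \<subseteq> V \<and> (\<forall>m. Poly_Mapping.keys m \<in> F \<longrightarrow> Poly_Mapping.lookup p m = 0)}"

lemma prod_mvar:
  "(\<Prod>v\<in>S. mvar v) = Poly_Mapping.single (\<Sum>v\<in>S. Poly_Mapping.single v 1) (1::'k::field)"
  unfolding mvar_def prod_single_one ..

lemma keys_sum_single_one:
  assumes "finite S"
  shows "Poly_Mapping.keys (\<Sum>v\<in>S. Poly_Mapping.single v (1::nat)) = S"
  using assms by (auto simp: in_keys_iff lookup_sum lookup_single when_def split: if_splits)

text \<open>A term of x * p has exponent i + j with j from p. If its support is a face, then the
  support of j, being contained in it, is a face as well, which is impossible. This is where
  \<open>F\<close> has to be closed under subsets.\<close>

lemma ideal_face_free:
  fixes k :: "'k::field itself" and V :: "'v set"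
  assumes "\<And>S T. T \<in> F \<Longrightarrow> S \<subseteq> T \<Longrightarrow> S \<in> F"
  shows "ideal (face_free V F) (poly_ring k V)"
proof -
  interpret R: cring "poly_ring k V" by (rule cring_poly_ring)
  have mult: "x * p \<in> face_free V F" if "p \<in> face_free V F" "poly_vars x \<subseteq> V"
    for x p :: "('v, 'k) mpoly"
  proof -
    have "Poly_Mapping.keys m \<notin> F" if m: "m \<in> Poly_Mapping.keys (x * p)" for m
    proof
      assume F: "Poly_Mapping.keys m \<in> F"
      obtain i j where "m = i + j" "j \<in> Poly_Mapping.keys p"
        using m keys_mult[of x p] by auto
      with F have "Poly_Mapping.keys j \<in> F"
        by (auto intro: assms simp: keys_add_monom)
      with \<open>p \<in> face_free V F\<close> \<open>j \<in> _\<close> show False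
        by (auto simp: face_free_def in_keys_iff)
    qed
    then show ?thesis
      using that poly_vars_mult[of x p] by (auto simp: face_free_def in_keys_iff)
  qed
  show ?thesis
  proof (rule idealI[OF R.ring_axioms])
    show "subgroup (face_free V F) (add_monoid (poly_ring k V))"
    proof (rule R.add.subgroupI)
      fix p :: "('v, 'k) mpoly" assume p: "p \<in> face_free V F"
      then have "poly_vars p \<subseteq> V" by (simp add: face_free_def)
      then have "\<ominus>\<^bsub>poly_ring k V\<^esub> p = - p"
        by (intro R.minus_equality)
          (auto simp: carrier_poly_ring poly_vars_def in_keys_iff)
      then show "\<ominus>\<^bsub>poly_ring k V\<^esub> p \<in> face_free V F"
        using p by (simp only:) (auto simp: face_free_def poly_vars_def in_keys_iff)
    next
      fix p q :: "('v, 'k) mpoly" assume "p \<in> face_free V F" "q \<in> face_free V F"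
      then show "p \<oplus>\<^bsub>poly_ring k V\<^esub> q \<in> face_free V F"
        using poly_vars_add[of p q] by (auto simp: face_free_def lookup_add)
    qed (auto simp: face_free_def carrier_poly_ring intro!: exI[of _ 0])
  next
    fix p x :: "('v, 'k) mpoly" assume "p \<in> face_free V F" "x \<in> carrier (poly_ring k V)"
    then show "x \<otimes>\<^bsub>poly_ring k V\<^esub> p \<in> face_free V F" "p \<otimes>\<^bsub>poly_ring k V\<^esub> x \<in> face_free V F"
      using mult[of p x] by (auto simp: carrier_poly_ring mult.commute)
  qed
qed

text \<open>A monomial whose support is not a face is a multiple of the squarefree monomial with the
  same support, which is a generator; so each term of an element of \<open>face_free V F\<close>
  lies in the generated ideal. The other inclusion holds because \<open>face_free V F\<close> is an
  ideal that contains the generators.\<close>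

lemma Idl_nonfaces:
  fixes k :: "'k::field itself"
  assumes "finite V" "\<And>S T. T \<in> F \<Longrightarrow> S \<subseteq> T \<Longrightarrow> S \<in> F"
  shows "Idl\<^bsub>poly_ring k V\<^esub> {\<Prod>v\<in>\<sigma>. mvar v | \<sigma>. \<sigma> \<subseteq> V \<and> \<sigma> \<notin> F} = face_free V F"
    (is "Idl\<^bsub>?R\<^esub> ?gens = _")
proof -
  interpret R: cring ?R by (rule cring_poly_ring)
  have keys: "Poly_Mapping.keys (\<Sum>v\<in>\<sigma>. Poly_Mapping.single v (1::nat)) = \<sigma>" if "\<sigma> \<subseteq> V" for \<sigma>
    by (rule keys_sum_single_one[OF finite_subset[OF that assms(1)]])
  have gens: "?gens \<subseteq> face_free V F"
    by (auto simp: prod_mvar face_free_def poly_vars_def keys[unfolded One_nat_def] lookup_single when_def)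
  have gens_carr: "?gens \<subseteq> carrier ?R"
    using gens by (auto simp: face_free_def carrier_poly_ring)
  interpret J: ideal "Idl\<^bsub>?R\<^esub> ?gens" ?R
    by (rule R.genideal_ideal[OF gens_carr])
  show ?thesis
  proof
    show "Idl\<^bsub>?R\<^esub> ?gens \<subseteq> face_free V F"
      by (rule R.genideal_minimal[OF ideal_face_free gens]) (rule assms(2))
  next
    show "face_free V F \<subseteq> Idl\<^bsub>?R\<^esub> ?gens"
    proof
      fix p :: "('a, 'k) mpoly" assume p: "p \<in> face_free V F"
      have "Poly_Mapping.single m (Poly_Mapping.lookup p m) \<in> Idl\<^bsub>?R\<^esub> ?gens"
        if m: "m \<in> Poly_Mapping.keys p" for m
      proof -
        let ?s = "\<Sum>v\<in>Poly_Mapping.keys m. Poly_Mapping.single v (1::nat)"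
        let ?g = "\<Prod>v\<in>Poly_Mapping.keys m. (mvar v :: ('a, 'k) mpoly)"
        let ?c = "Poly_Mapping.single (m - ?s) (Poly_Mapping.lookup p m)"
        have V: "Poly_Mapping.keys m \<subseteq> V" and F: "Poly_Mapping.keys m \<notin> F"
          using p m by (auto simp: face_free_def poly_vars_def)
        \<comment> \<open>Subtraction of exponents is truncated; it is exact here because every
          variable in the support of m has exponent at least 1.\<close>
        have "m - ?s + ?s = m"
          by (rule poly_mapping_eqI)
            (auto simp: lookup_add lookup_minus lookup_sum lookup_single when_def in_keys_iff)
        then have eq: "Poly_Mapping.single m (Poly_Mapping.lookup p m) = ?c * ?g"
          by (simp add: prod_mvar mult_single)
        have "?g \<in> Idl\<^bsub>?R\<^esub> ?gens"
          using V F by (intro subsetD[OF R.genideal_self[OF gens_carr]]) auto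
        moreover have "?c \<in> carrier ?R"
        proof -
          have "Poly_Mapping.keys (m - ?s) \<subseteq> Poly_Mapping.keys m"
            by (auto simp: in_keys_iff lookup_minus)
          then show ?thesis
            using V by (auto simp: carrier_poly_ring poly_vars_def split: if_splits)
        qed
        ultimately show ?thesis
          unfolding eq using J.I_l_closed by fastforce
      qed
      note single = this
      have "(\<Sum>m\<in>A. Poly_Mapping.single m (Poly_Mapping.lookup p m)) \<in> Idl\<^bsub>?R\<^esub> ?gens"
        if "finite A" "A \<subseteq> Poly_Mapping.keys p" for A
        using that
      proof (induction A rule: finite_induct)
        case empty
        show ?case using J.zero_closed by simp
      next
        case (insert m A)
        then show ?case using J.a_closed[OF single[of m]] by simp
      qed
      from this[OF finite_keys order_refl]
      show "p \<in> Idl\<^bsub>?R\<^esub> ?gens"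
        by (simp flip: poly_mapping_sum_single)
    qed
  qed
qed

section \<open>Families of polynomials over the maximal elements\<close>

text \<open>The last assumption makes each lower interval behave like a simplex: every set of atoms
  below p is the set of atoms below some element of the interval. All four properties can be checked
  for the orbit poset by lifting to P.\<close>

locale face_poset =
  fixes P :: "('p, 'm) gorder_scheme"
  assumes le_refl: "x \<in> carrier P \<Longrightarrow> x \<sqsubseteq>\<^bsub>P\<^esub> x"
    and le_trans: "\<lbrakk>x \<sqsubseteq>\<^bsub>P\<^esub> y; y \<sqsubseteq>\<^bsub>P\<^esub> z; x \<in> carrier P; y \<in> carrier P; z \<in> carrier P\<rbrakk> \<Longrightarrow> x \<sqsubseteq>\<^bsub>P\<^esub> z"
    and finite_below: "p \<in> carrier P \<Longrightarrow> finite (below P p)"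
    and subface_exists: "\<lbrakk>p \<in> carrier P; S \<subseteq> {v \<in> atoms P. v \<sqsubseteq>\<^bsub>P\<^esub> p}\<rbrakk>
      \<Longrightarrow> \<exists>x\<in>carrier P. x \<sqsubseteq>\<^bsub>P\<^esub> p \<and> {v \<in> atoms P. v \<sqsubseteq>\<^bsub>P\<^esub> x} = S"

definition local_ideal :: "('p, 'm) gorder_scheme \<Rightarrow> 'p set \<Rightarrow> bool" where
  "local_ideal P \<aa> \<longleftrightarrow> (\<exists>p\<in>carrier P. \<aa> \<subseteq> below P p) \<and> (\<forall>x\<in>\<aa>. below P x \<subseteq> \<aa>)"

definition SR_coset ::
    "'k::field itself \<Rightarrow> ('p, 'm) gorder_scheme \<Rightarrow> 'p set \<Rightarrow> ('p, 'k) mpoly \<Rightarrow> ('p, 'k) mpoly set" where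
  "SR_coset k P \<aa> p = local_SR_ideal k P \<aa> +>\<^bsub>local_poly_ring k P \<aa>\<^esub> p"

text \<open>The condition is indexed by common lower bounds x and not by monomials in common
  variables: two maximal edges with the same endpoints share both variables, yet their coefficients
  at multiples of the product of the two variables are independent of each other.\<close>

definition max_families ::
    "'k::field itself \<Rightarrow> ('p, 'm) gorder_scheme \<Rightarrow> ('p \<Rightarrow> ('p, 'k) mpoly) set" where
  "max_families k P = {f \<in> extensional (maximals P).
     (\<forall>t\<in>maximals P. poly_vars (f t) \<subseteq> atoms P \<inter> below P t) \<and>
     (\<forall>t\<in>maximals P. \<forall>u\<in>maximals P. \<forall>x\<in>below P t \<inter> below P u. \<forall>m.
        Poly_Mapping.keys m = {v \<in> atoms P. v \<sqsubseteq>\<^bsub>P\<^esub> x} \<longrightarrow>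
        Poly_Mapping.lookup (f t) m = Poly_Mapping.lookup (f u) m)}"

text \<open>For the orbit poset this is the common target of the comparison: the invariant ring and
  \<open>SR_ring k Q\<close> are both mapped isomorphically onto
  \<open>max_ring k Q\<close>.\<close>

definition max_ring ::
    "'k::field itself \<Rightarrow> ('p, 'm) gorder_scheme \<Rightarrow> ('p \<Rightarrow> ('p, 'k) mpoly) ring" where
  "max_ring k P =
    \<lparr>carrier = max_families k P,
     mult = (\<lambda>f g. \<lambda>t\<in>maximals P. f t * g t), one = (\<lambda>t\<in>maximals P. 1),
     zero = (\<lambda>t\<in>maximals P. 0), add = (\<lambda>f g. \<lambda>t\<in>maximals P. f t + g t)\<rparr>"

text \<open>\<open>the_elem\<close> extracts the polynomial because the class at the lower interval
  of a maximal element is a singleton.\<close>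

definition max_part ::
    "('p, 'm) gorder_scheme \<Rightarrow> ('p set \<Rightarrow> ('p, 'k::field) mpoly set) \<Rightarrow> 'p \<Rightarrow> ('p, 'k) mpoly" where
  "max_part P q = (\<lambda>t\<in>maximals P. the_elem (q (below P t)))"

text \<open>For a compatible family the class does not depend on the maximal element chosen above
  the ideal; this is \<open>max_glue_eq\<close>.\<close>

definition max_glue ::
    "'k::field itself \<Rightarrow> ('p, 'm) gorder_scheme \<Rightarrow> ('p \<Rightarrow> ('p, 'k) mpoly) \<Rightarrow> 'p set \<Rightarrow> ('p, 'k) mpoly set" where
  "max_glue k P f = (\<lambda>\<aa>\<in>max_meets P. SR_coset k P \<aa>
     (restrict_poly \<aa> (f (SOME t. t \<in> maximals P \<and> \<aa> \<subseteq> below P t))))"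

lemma maximals_carrier: "t \<in> maximals P \<Longrightarrow> t \<in> carrier P"
  by (simp add: maximals_def)

lemma atoms_carrier: "v \<in> atoms P \<Longrightarrow> v \<in> carrier P"
  by (simp add: atoms_def)

lemma max_meets_below:
  assumes "\<aa> \<in> max_meets P"
  obtains t where "t \<in> maximals P" "\<aa> \<subseteq> below P t"
  using assms by (auto simp: max_meets_def)

lemma below_in_max_meets: "t \<in> maximals P \<Longrightarrow> below P t \<in> max_meets P"
  unfolding max_meets_def by (intro CollectI exI[of _ "{t}"]) auto

lemma below_Int_in_max_meets:
  "\<lbrakk>t \<in> maximals P; u \<in> maximals P\<rbrakk> \<Longrightarrow> below P t \<inter> below P u \<in> max_meets P"
  unfolding max_meets_def by (intro CollectI exI[of _ "{t, u}"]) auto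

section \<open>Local rings and projections in terms of coefficients\<close>

context face_poset
begin

lemma below_mono: "y \<in> below P x \<Longrightarrow> x \<in> carrier P \<Longrightarrow> below P y \<subseteq> below P x"
  by (auto simp: below_def intro: le_trans)

lemma local_ideal_max_meets:
  assumes "\<aa> \<in> max_meets P"
  shows "local_ideal P \<aa>"
proof -
  obtain \<tau> where \<tau>: "\<tau> \<noteq> {}" "\<tau> \<subseteq> maximals P" "\<aa> = (\<Inter>t\<in>\<tau>. below P t)"
    using assms by (auto simp: max_meets_def)
  have "below P x \<subseteq> below P t" if "x \<in> \<aa>" "t \<in> \<tau>" for x t
    using that \<tau> by (intro below_mono maximals_carrier) auto
  then have "below P x \<subseteq> \<aa>" if "x \<in> \<aa>" for x
    using that unfolding \<tau>(3) by (intro INT_greatest)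
  moreover obtain t where "t \<in> \<tau>" using \<tau>(1) by auto
  then have "\<exists>p\<in>carrier P. \<aa> \<subseteq> below P p"
    using \<tau> by (intro bexI[of _ t]) (auto intro: maximals_carrier)
  ultimately show ?thesis by (simp add: local_ideal_def)
qed

lemma finite_local_ideal: "local_ideal P \<aa> \<Longrightarrow> finite \<aa>"
  using finite_below by (auto simp: local_ideal_def intro: finite_subset)

lemma local_ideal_carrier: "local_ideal P \<aa> \<Longrightarrow> \<aa> \<subseteq> carrier P"
  by (auto simp: local_ideal_def below_def)

lemma face_sets_subset: "local_ideal P \<aa> \<Longrightarrow> S \<in> face_sets P \<aa> \<Longrightarrow> S \<subseteq> atoms P \<inter> \<aa>"
  unfolding face_sets_def local_ideal_def below_def using atoms_carrier[of _ P] by blast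

text \<open>A face consists of the atoms below some x of the ideal; a subset of it is realised by an
  element below x, which again belongs to the ideal.\<close>

lemma face_sets_down_closed:
  assumes "local_ideal P \<aa>" "T \<in> face_sets P \<aa>" "S \<subseteq> T"
  shows "S \<in> face_sets P \<aa>"
proof -
  obtain x where x: "x \<in> \<aa>" "T = {v \<in> atoms P. v \<sqsubseteq>\<^bsub>P\<^esub> x}"
    using assms(2) by (auto simp: face_sets_def)
  moreover have "x \<in> carrier P" using x assms(1) local_ideal_carrier by blast
  ultimately obtain y where "y \<in> carrier P" "y \<sqsubseteq>\<^bsub>P\<^esub> x" "{v \<in> atoms P. v \<sqsubseteq>\<^bsub>P\<^esub> y} = S"
    using subface_exists[of x S] assms(3) by blast
  moreover have "y \<in> \<aa>"
    using calculation x assms(1) by (auto simp: local_ideal_def below_def)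
  ultimately show ?thesis by (auto simp: face_sets_def)
qed

lemma face_sets_mono: "\<bb> \<subseteq> \<aa> \<Longrightarrow> face_sets P \<bb> \<subseteq> face_sets P \<aa>"
  by (auto simp: face_sets_def)

lemma face_sets_below:
  assumes "t \<in> carrier P" "S \<subseteq> atoms P \<inter> below P t"
  shows "S \<in> face_sets P (below P t)"
proof -
  obtain x where "x \<in> carrier P" "x \<sqsubseteq>\<^bsub>P\<^esub> t" "{v \<in> atoms P. v \<sqsubseteq>\<^bsub>P\<^esub> x} = S"
    using subface_exists[of t S] assms by (auto simp: below_def)
  then show ?thesis by (auto simp: face_sets_def below_def)
qed

lemma local_SR_ideal_eq:
  assumes "local_ideal P \<aa>"
  shows "local_SR_ideal k P \<aa> = face_free (atoms P \<inter> \<aa>) (face_sets P \<aa>)"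
  unfolding local_SR_ideal_def local_poly_ring_def
  by (rule Idl_nonfaces)
    (use assms face_sets_down_closed finite_local_ideal in auto)

lemma ideal_local_SR_ideal:
  assumes "local_ideal P \<aa>"
  shows "ideal (local_SR_ideal k P \<aa>) (local_poly_ring k P \<aa>)"
  unfolding local_SR_ideal_eq[OF assms] local_poly_ring_def
  using face_sets_down_closed[OF assms] by (rule ideal_face_free)

text \<open>Two representatives differ by an element of \<open>face_free\<close>, so a class is
  determined by the coefficients at monomials supported on faces. Equality in the local rings
  becomes equality of these coefficients.\<close>

lemma SR_coset_eq:
  assumes "local_ideal P \<aa>" "poly_vars p \<subseteq> atoms P \<inter> \<aa>"
  shows "SR_coset k P \<aa> p = {q. poly_vars q \<subseteq> atoms P \<inter> \<aa> \<and>
     (\<forall>m. Poly_Mapping.keys m \<in> face_sets P \<aa> \<longrightarrow> Poly_Mapping.lookup q m = Poly_Mapping.lookup p m)}"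
    (is "_ = ?C")
proof
  show "SR_coset k P \<aa> p \<subseteq> ?C"
  proof
    fix q assume "q \<in> SR_coset k P \<aa> p"
    then obtain r where "r \<in> face_free (atoms P \<inter> \<aa>) (face_sets P \<aa>)" "q = r + p"
      by (auto simp: SR_coset_def local_SR_ideal_eq[OF assms(1)] a_r_coset_def' local_poly_ring_def)
    then show "q \<in> ?C"
      using assms(2) poly_vars_add[of r p] by (auto simp: face_free_def lookup_add)
  qed
  show "?C \<subseteq> SR_coset k P \<aa> p"
  proof
    fix q assume q: "q \<in> ?C"
    then have "q - p \<in> face_free (atoms P \<inter> \<aa>) (face_sets P \<aa>)"
      using assms(2) poly_vars_diff[of q p] by (auto simp: face_free_def lookup_minus)
    then show "q \<in> SR_coset k P \<aa> p"
      by (auto simp: SR_coset_def local_SR_ideal_eq[OF assms(1)] a_r_coset_def' local_poly_ring_def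
          intro!: bexI[of _ "q - p"])
  qed
qed

lemma SR_coset_self:
  "\<lbrakk>local_ideal P \<aa>; poly_vars p \<subseteq> atoms P \<inter> \<aa>\<rbrakk> \<Longrightarrow> p \<in> SR_coset k P \<aa> p"
  by (simp add: SR_coset_eq)

lemma SR_coset_eq_iff:
  assumes "local_ideal P \<aa>" "poly_vars p \<subseteq> atoms P \<inter> \<aa>" "poly_vars q \<subseteq> atoms P \<inter> \<aa>"
  shows "SR_coset k P \<aa> p = SR_coset k P \<aa> q \<longleftrightarrow>
    (\<forall>m. Poly_Mapping.keys m \<in> face_sets P \<aa> \<longrightarrow> Poly_Mapping.lookup p m = Poly_Mapping.lookup q m)"
proof
  assume "SR_coset k P \<aa> p = SR_coset k P \<aa> q"
  with SR_coset_self[OF assms(1,2)] have "p \<in> SR_coset k P \<aa> q" by blast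
  then show "\<forall>m. Poly_Mapping.keys m \<in> face_sets P \<aa> \<longrightarrow>
      Poly_Mapping.lookup p m = Poly_Mapping.lookup q m"
    by (simp add: SR_coset_eq[OF assms(1,3)])
qed (simp add: SR_coset_eq[OF assms(1,2)] SR_coset_eq[OF assms(1,3)])

lemma SR_coset_below:
  assumes "t \<in> carrier P" "poly_vars p \<subseteq> atoms P \<inter> below P t"
  shows "SR_coset k P (below P t) p = {p}"
proof -
  have I: "local_ideal P (below P t)"
    using assms(1) below_mono by (auto simp: local_ideal_def)
  show ?thesis
    unfolding SR_coset_eq[OF I assms(2)]
    using assms face_sets_below[OF assms(1)]
    by (auto intro: poly_mapping_eqI_vars[of _ "atoms P \<inter> below P t"])
qed

lemma carrier_local_SR_ring:
  "carrier (local_SR_ring k P \<aa>) = SR_coset k P \<aa> ` {p. poly_vars p \<subseteq> atoms P \<inter> \<aa>}"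
  by (auto simp: local_SR_ring_def FactRing_def A_RCOSETS_def' SR_coset_def local_poly_ring_def
      carrier_poly_ring)

lemma local_SR_ring_ops:
  assumes "local_ideal P \<aa>" "poly_vars p \<subseteq> atoms P \<inter> \<aa>" "poly_vars q \<subseteq> atoms P \<inter> \<aa>"
  shows "SR_coset k P \<aa> p \<otimes>\<^bsub>local_SR_ring k P \<aa>\<^esub> SR_coset k P \<aa> q = SR_coset k P \<aa> (p * q)"
    and "SR_coset k P \<aa> p \<oplus>\<^bsub>local_SR_ring k P \<aa>\<^esub> SR_coset k P \<aa> q = SR_coset k P \<aa> (p + q)"
proof -
  interpret ideal "local_SR_ideal k P \<aa>" "local_poly_ring k P \<aa>"
    by (rule ideal_local_SR_ideal[OF assms(1)])
  have "p \<in> carrier (local_poly_ring k P \<aa>)" "q \<in> carrier (local_poly_ring k P \<aa>)"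
    using assms by (auto simp: local_poly_ring_def carrier_poly_ring)
  from rcoset_mult_add[OF this] a_rcos_sum[OF this]
  show "SR_coset k P \<aa> p \<otimes>\<^bsub>local_SR_ring k P \<aa>\<^esub> SR_coset k P \<aa> q = SR_coset k P \<aa> (p * q)"
    and "SR_coset k P \<aa> p \<oplus>\<^bsub>local_SR_ring k P \<aa>\<^esub> SR_coset k P \<aa> q = SR_coset k P \<aa> (p + q)"
    by (simp_all add: local_SR_ring_def FactRing_def SR_coset_def local_poly_ring_def)
qed

lemma local_SR_ring_one: "\<one>\<^bsub>local_SR_ring k P \<aa>\<^esub> = SR_coset k P \<aa> 1"
  by (simp add: local_SR_ring_def FactRing_def SR_coset_def local_poly_ring_def)

text \<open>The hypothesis on h makes the set in \<open>quot_map\<close> a singleton, so that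
  \<open>the_elem\<close> returns the expected class.\<close>

lemma quot_map_coset:
  assumes "local_ideal P \<aa>" "poly_vars p \<subseteq> atoms P \<inter> \<aa>"
    and "\<And>q. q \<in> SR_coset k P \<aa> p \<Longrightarrow> SR_coset k P \<bb> (h q) = SR_coset k P \<bb> (h p)"
  shows "quot_map (local_poly_ring k P \<bb>) (local_SR_ideal k P \<bb>) h (SR_coset k P \<aa> p)
    = SR_coset k P \<bb> (h p)"
proof -
  have "(\<lambda>q. SR_coset k P \<bb> (h q)) ` SR_coset k P \<aa> p =
      (\<lambda>q. SR_coset k P \<bb> (h p)) ` SR_coset k P \<aa> p"
    by (rule image_cong[OF refl assms(3)])
  also have "\<dots> = {SR_coset k P \<bb> (h p)}"
    by (rule image_constant[OF SR_coset_self[OF assms(1,2)]])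
  finally have "(\<lambda>q. SR_coset k P \<bb> (h q)) ` SR_coset k P \<aa> p = {SR_coset k P \<bb> (h p)}" .
  then show ?thesis
    by (simp add: quot_map_def SR_coset_def)
qed

text \<open>Faces of the smaller ideal are faces of the larger one, so the class of the truncation
  does not depend on the representative.\<close>

lemma SR_proj_coset:
  assumes "local_ideal P \<aa>" "local_ideal P \<bb>" "\<bb> \<subseteq> \<aa>" "poly_vars p \<subseteq> atoms P \<inter> \<aa>"
  shows "SR_proj k P \<bb> (SR_coset k P \<aa> p) = SR_coset k P \<bb> (restrict_poly \<bb> p)"
  unfolding SR_proj_def restrict_poly_def[symmetric]
proof (rule quot_map_coset[OF assms(1,4)])
  fix q assume q: "q \<in> SR_coset k P \<aa> p"
  then have "poly_vars q \<subseteq> atoms P \<inter> \<aa>" by (simp add: SR_coset_eq[OF assms(1,4)])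
  moreover have "Poly_Mapping.lookup (restrict_poly \<bb> q) m = Poly_Mapping.lookup (restrict_poly \<bb> p) m"
    if "Poly_Mapping.keys m \<in> face_sets P \<bb>" for m
    using that q face_sets_mono[OF assms(3)] by (auto simp: SR_coset_eq[OF assms(1,4)] lookup_restrict_poly)
  ultimately show "SR_coset k P \<bb> (restrict_poly \<bb> q) = SR_coset k P \<bb> (restrict_poly \<bb> p)"
    using assms poly_vars_restrict_poly[of \<bb> p] poly_vars_restrict_poly[of \<bb> q]
    by (subst SR_coset_eq_iff) auto
qed

section \<open>Components at the maximal intervals\<close>

lemma SR_ring_coset:
  assumes "q \<in> carrier (SR_ring k P)" "\<aa> \<in> max_meets P"
  obtains p where "poly_vars p \<subseteq> atoms P \<inter> \<aa>" "q \<aa> = SR_coset k P \<aa> p"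
proof -
  have "q \<aa> \<in> carrier (local_SR_ring k P \<aa>)"
    using assms by (auto simp: SR_ring_def)
  then show thesis
    using that by (auto simp: carrier_local_SR_ring)
qed

lemma SR_ring_proj:
  assumes "q \<in> carrier (SR_ring k P)" "\<aa> \<in> max_meets P" "\<bb> \<in> max_meets P" "\<bb> \<subseteq> \<aa>"
  shows "SR_proj k P \<bb> (q \<aa>) = q \<bb>"
  using assms by (simp add: SR_ring_def)

lemma max_part:
  assumes "q \<in> carrier (SR_ring k P)" "t \<in> maximals P"
  shows poly_vars_max_part: "poly_vars (max_part P q t) \<subseteq> atoms P \<inter> below P t"
    and max_part_below: "q (below P t) = SR_coset k P (below P t) (max_part P q t)"
proof -
  obtain p where p: "poly_vars p \<subseteq> atoms P \<inter> below P t"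
      "q (below P t) = SR_coset k P (below P t) p"
    using SR_ring_coset[OF assms(1) below_in_max_meets[OF assms(2)]] .
  then have "max_part P q t = p"
    using assms(2) by (simp add: max_part_def SR_coset_below maximals_carrier)
  with p show "poly_vars (max_part P q t) \<subseteq> atoms P \<inter> below P t"
    and "q (below P t) = SR_coset k P (below P t) (max_part P q t)"
    by simp_all
qed

text \<open>This is the compatibility of q with the projection from the interval of t. As every
  ideal in \<open>max_meets P\<close> lies in such an interval, q is determined by
  \<open>max_part P q\<close>.\<close>

lemma SR_ring_eq_max_part:
  assumes "q \<in> carrier (SR_ring k P)" "t \<in> maximals P" "\<aa> \<in> max_meets P" "\<aa> \<subseteq> below P t"
  shows "q \<aa> = SR_coset k P \<aa> (restrict_poly \<aa> (max_part P q t))"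
proof -
  have "q \<aa> = SR_proj k P \<aa> (q (below P t))"
    using SR_ring_proj[OF assms(1) below_in_max_meets[OF assms(2)] assms(3,4)] by (rule sym)
  also have "\<dots> = SR_proj k P \<aa> (SR_coset k P (below P t) (max_part P q t))"
    by (simp only: max_part_below[OF assms(1,2)])
  also have "\<dots> = SR_coset k P \<aa> (restrict_poly \<aa> (max_part P q t))"
    by (rule SR_proj_coset[OF local_ideal_max_meets[OF below_in_max_meets[OF assms(2)]]
          local_ideal_max_meets[OF assms(3)] assms(4) poly_vars_max_part[OF assms(1,2)]])
  finally show ?thesis .
qed

text \<open>The polynomials at t and at u both truncate to representatives of the component of q at
  the intersection of the two intervals. The atoms below x form a face of that intersection, so the
  coefficient at m survives truncation and is visible in the local ring.\<close>

lemma max_part_families: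
  assumes "q \<in> carrier (SR_ring k P)"
  shows "max_part P q \<in> max_families k P"
proof -
  have "Poly_Mapping.lookup (max_part P q t) m = Poly_Mapping.lookup (max_part P q u) m"
    if tu: "t \<in> maximals P" "u \<in> maximals P" and x: "x \<in> below P t \<inter> below P u"
      and m: "Poly_Mapping.keys m = {v \<in> atoms P. v \<sqsubseteq>\<^bsub>P\<^esub> x}" for t u x m
  proof -
    let ?b = "below P t \<inter> below P u"
    have b: "?b \<in> max_meets P" by (rule below_Int_in_max_meets[OF tu])
    then have I: "local_ideal P ?b" by (rule local_ideal_max_meets)
    have face: "Poly_Mapping.keys m \<in> face_sets P ?b"
      using x m by (auto simp: face_sets_def)
    have "SR_coset k P ?b (restrict_poly ?b (max_part P q t)) =
        SR_coset k P ?b (restrict_poly ?b (max_part P q u))"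
      using SR_ring_eq_max_part[OF assms tu(1) b Int_lower1]
        SR_ring_eq_max_part[OF assms tu(2) b Int_lower2] by (rule trans[OF sym])
    moreover have vars: "poly_vars (restrict_poly ?b (max_part P q w)) \<subseteq> atoms P \<inter> ?b"
      if "w \<in> maximals P" for w
      using poly_vars_restrict_poly[of ?b "max_part P q w"] poly_vars_max_part[OF assms that] by blast
    ultimately have "Poly_Mapping.lookup (restrict_poly ?b (max_part P q t)) m =
        Poly_Mapping.lookup (restrict_poly ?b (max_part P q u)) m"
      using face SR_coset_eq_iff[OF I vars[OF tu(1)] vars[OF tu(2)], of k] by simp
    moreover have "Poly_Mapping.keys m \<subseteq> ?b"
      using face_sets_subset[OF I face] by blast
    ultimately show ?thesis by (simp add: lookup_restrict_poly)
  qed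
  moreover have "max_part P q \<in> extensional (maximals P)"
    by (simp add: max_part_def)
  ultimately show ?thesis
    unfolding max_families_def
    by (intro CollectI conjI ballI allI impI poly_vars_max_part[OF assms])
qed

lemma inj_on_max_part: "inj_on (max_part P) (carrier (SR_ring k P))"
proof (rule inj_onI)
  fix q r assume q: "q \<in> carrier (SR_ring k P)" and r: "r \<in> carrier (SR_ring k P)"
    and eq: "max_part P q = max_part P r"
  show "q = r"
  proof (rule extensionalityI)
    show "q \<in> extensional (max_meets P)" "r \<in> extensional (max_meets P)"
      using q r by (auto simp: SR_ring_def PiE_def)
    fix \<aa> assume a: "\<aa> \<in> max_meets P"
    then obtain t where t: "t \<in> maximals P" "\<aa> \<subseteq> below P t" by (rule max_meets_below)
    show "q \<aa> = r \<aa>"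
      by (simp add: SR_ring_eq_max_part[OF q t(1) a t(2)] SR_ring_eq_max_part[OF r t(1) a t(2)] eq)
  qed
qed

section \<open>Gluing a compatible family\<close>

lemma max_families_poly_vars:
  "f \<in> max_families k P \<Longrightarrow> t \<in> maximals P \<Longrightarrow> poly_vars (f t) \<subseteq> atoms P \<inter> below P t"
  by (simp add: max_families_def)

lemma max_families_compat:
  assumes "f \<in> max_families k P" "t \<in> maximals P" "u \<in> maximals P"
    and "\<aa> \<subseteq> below P t" "\<aa> \<subseteq> below P u" "Poly_Mapping.keys m \<in> face_sets P \<aa>"
  shows "Poly_Mapping.lookup (f t) m = Poly_Mapping.lookup (f u) m"
proof -
  obtain x where "x \<in> \<aa>" "Poly_Mapping.keys m = {v \<in> atoms P. v \<sqsubseteq>\<^bsub>P\<^esub> x}"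
    using assms(6) by (auto simp: face_sets_def)
  moreover from this have "x \<in> below P t \<inter> below P u"
    using assms(4,5) by blast
  ultimately show ?thesis
    using assms(1-3) unfolding max_families_def by blast
qed

text \<open>A face of the ideal comes from an element x of it, and x lies below both t and the
  chosen maximal element. Compatibility at x makes the two truncations agree at the face
  monomials.\<close>

lemma max_glue_eq:
  assumes "f \<in> max_families k P" "\<aa> \<in> max_meets P" "t \<in> maximals P" "\<aa> \<subseteq> below P t"
  shows "max_glue k P f \<aa> = SR_coset k P \<aa> (restrict_poly \<aa> (f t))"
proof -
  let ?u = "SOME t. t \<in> maximals P \<and> \<aa> \<subseteq> below P t"
  have u: "?u \<in> maximals P \<and> \<aa> \<subseteq> below P ?u"
    by (rule someI[of _ t]) (use assms in simp)
  have I: "local_ideal P \<aa>" by (rule local_ideal_max_meets[OF assms(2)])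
  have "SR_coset k P \<aa> (restrict_poly \<aa> (f ?u)) = SR_coset k P \<aa> (restrict_poly \<aa> (f t))"
  proof (subst SR_coset_eq_iff[OF I])
    show "poly_vars (restrict_poly \<aa> (f ?u)) \<subseteq> atoms P \<inter> \<aa>"
      "poly_vars (restrict_poly \<aa> (f t)) \<subseteq> atoms P \<inter> \<aa>"
      using poly_vars_restrict_poly[of \<aa> "f t"] poly_vars_restrict_poly[of \<aa> "f ?u"]
        max_families_poly_vars[OF assms(1)] u assms(3) by blast+
    show "\<forall>m. Poly_Mapping.keys m \<in> face_sets P \<aa> \<longrightarrow>
      Poly_Mapping.lookup (restrict_poly \<aa> (f ?u)) m = Poly_Mapping.lookup (restrict_poly \<aa> (f t)) m"
      using max_families_compat[OF assms(1), of ?u t \<aa>] u assms(3,4)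
      by (simp add: lookup_restrict_poly)
  qed
  then show ?thesis
    using assms(2) by (simp add: max_glue_def)
qed

text \<open>A maximal element above \<open>\<aa>\<close> is also above \<open>\<bb>\<close>, so both
  components can be computed from one polynomial, and truncating twice amounts to truncating to the
  smaller ideal.\<close>

lemma max_glue_in_SR_ring:
  assumes f: "f \<in> max_families k P"
  shows "max_glue k P f \<in> carrier (SR_ring k P)"
proof -
  have vars: "poly_vars (restrict_poly \<aa> (f t)) \<subseteq> atoms P \<inter> \<aa>" if "t \<in> maximals P" for \<aa> t
    using poly_vars_restrict_poly[of \<aa> "f t"] max_families_poly_vars[OF f that] by blast
  have "max_glue k P f \<in> (\<Pi>\<^sub>E \<aa>\<in>max_meets P. carrier (local_SR_ring k P \<aa>))"
  proof (rule PiE_I)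
    fix \<aa> assume a: "\<aa> \<in> max_meets P"
    then obtain t where t: "t \<in> maximals P" "\<aa> \<subseteq> below P t" by (rule max_meets_below)
    show "max_glue k P f \<aa> \<in> carrier (local_SR_ring k P \<aa>)"
      using vars[OF t(1)] by (auto simp: max_glue_eq[OF f a t] carrier_local_SR_ring)
  qed (simp add: max_glue_def)
  moreover have "SR_proj k P \<bb> (max_glue k P f \<aa>) = max_glue k P f \<bb>"
    if a: "\<aa> \<in> max_meets P" and b: "\<bb> \<in> max_meets P" and "\<bb> \<subseteq> \<aa>" for \<aa> \<bb>
  proof -
    obtain t where t: "t \<in> maximals P" "\<aa> \<subseteq> below P t" using a by (rule max_meets_below)
    have Ib: "local_ideal P \<bb>" by (rule local_ideal_max_meets[OF b])
    have "SR_proj k P \<bb> (max_glue k P f \<aa>) =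
        SR_coset k P \<bb> (restrict_poly \<bb> (restrict_poly \<aa> (f t)))"
      unfolding max_glue_eq[OF f a t]
      by (rule SR_proj_coset[OF local_ideal_max_meets[OF a] Ib that(3) vars[OF t(1)]])
    also have "restrict_poly \<bb> (restrict_poly \<aa> (f t)) = restrict_poly \<bb> (f t)"
      by (rule poly_mapping_eqI) (use that(3) in \<open>auto simp: lookup_restrict_poly\<close>)
    finally show ?thesis
      using max_glue_eq[OF f b t(1)] t(2) that(3) by auto
  qed
  ultimately show ?thesis by (simp add: SR_ring_def)
qed

lemma max_part_max_glue:
  assumes f: "f \<in> max_families k P"
  shows "max_part P (max_glue k P f) = f"
proof (rule extensionalityI)
  show "max_part P (max_glue k P f) \<in> extensional (maximals P)" "f \<in> extensional (maximals P)"
    using f by (auto simp: max_part_def max_families_def)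
  fix t assume t: "t \<in> maximals P"
  have vars: "poly_vars (f t) \<subseteq> atoms P \<inter> below P t"
    by (rule max_families_poly_vars[OF f t])
  have r: "restrict_poly (below P t) (f t) = f t"
    by (rule poly_mapping_eqI)
      (use vars in \<open>fastforce simp: lookup_restrict_poly poly_vars_def in_keys_iff[of _ "f t"]\<close>)
  show "max_part P (max_glue k P f) t = f t"
    using t max_glue_eq[OF f below_in_max_meets[OF t] t order_refl] vars
    by (simp add: max_part_def r SR_coset_below maximals_carrier)
qed

lemma bij_betw_max_part:
  "bij_betw (max_part P) (carrier (SR_ring k P)) (max_families k P)"
  unfolding bij_betw_def
proof (intro conjI inj_on_max_part equalityI subsetI)
  fix f assume "f \<in> max_families k P"
  then show "f \<in> max_part P ` carrier (SR_ring k P)"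
    using max_part_max_glue[of f k] max_glue_in_SR_ring[of f k] by (metis image_eqI)
qed (auto intro: max_part_families)

section \<open>Compatibility with the ring operations\<close>

lemma SR_ring_simps:
  "q \<otimes>\<^bsub>SR_ring k P\<^esub> r = (\<lambda>\<aa>\<in>max_meets P. q \<aa> \<otimes>\<^bsub>local_SR_ring k P \<aa>\<^esub> r \<aa>)"
  "q \<oplus>\<^bsub>SR_ring k P\<^esub> r = (\<lambda>\<aa>\<in>max_meets P. q \<aa> \<oplus>\<^bsub>local_SR_ring k P \<aa>\<^esub> r \<aa>)"
  "\<one>\<^bsub>SR_ring k P\<^esub> = (\<lambda>\<aa>\<in>max_meets P. \<one>\<^bsub>local_SR_ring k P \<aa>\<^esub>)"
  by (simp_all add: SR_ring_def)

lemma SR_ring_closed: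
  assumes q: "q \<in> carrier (SR_ring k P)" and r: "r \<in> carrier (SR_ring k P)"
  shows "q \<otimes>\<^bsub>SR_ring k P\<^esub> r \<in> carrier (SR_ring k P)" (is ?mult)
    and "q \<oplus>\<^bsub>SR_ring k P\<^esub> r \<in> carrier (SR_ring k P)" (is ?add)
proof -
  \<comment> \<open>Sum and product are treated together: it suffices that the operation is induced
    by one on polynomials which introduces no new variables and commutes with truncation.\<close>
  have mem: "s \<in> carrier (SR_ring k P)"
    if ext: "s \<in> extensional (max_meets P)"
      and s: "\<And>\<aa> a b. \<lbrakk>\<aa> \<in> max_meets P; poly_vars a \<subseteq> atoms P \<inter> \<aa>; poly_vars b \<subseteq> atoms P \<inter> \<aa>;
          q \<aa> = SR_coset k P \<aa> a; r \<aa> = SR_coset k P \<aa> b\<rbrakk>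
        \<Longrightarrow> s \<aa> = SR_coset k P \<aa> (op a b)"
      and op_vars: "\<And>a b. poly_vars (op a b) \<subseteq> poly_vars a \<union> poly_vars b"
      and op_res: "\<And>B a b. restrict_poly B (op a b) = op (restrict_poly B a) (restrict_poly B b)"
    for s :: "'p set \<Rightarrow> ('p, 'a) mpoly set" and op :: "('p, 'a) mpoly \<Rightarrow> ('p, 'a) mpoly \<Rightarrow> ('p, 'a) mpoly"
  proof -
    have 1: "s \<aa> \<in> carrier (local_SR_ring k P \<aa>)" if a: "\<aa> \<in> max_meets P" for \<aa>
    proof -
      obtain a where a': "poly_vars a \<subseteq> atoms P \<inter> \<aa>" "q \<aa> = SR_coset k P \<aa> a"
        using q a by (rule SR_ring_coset)
      obtain b where b': "poly_vars b \<subseteq> atoms P \<inter> \<aa>" "r \<aa> = SR_coset k P \<aa> b"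
        using r a by (rule SR_ring_coset)
      show ?thesis
        unfolding s[OF a a'(1) b'(1) a'(2) b'(2)] carrier_local_SR_ring
        by (rule imageI) (use op_vars[of a b] a' b' in blast)
    qed
    have 2: "SR_proj k P \<bb> (s \<aa>) = s \<bb>"
      if a: "\<aa> \<in> max_meets P" and b: "\<bb> \<in> max_meets P" and sub: "\<bb> \<subseteq> \<aa>" for \<aa> \<bb>
    proof -
      note Ia = local_ideal_max_meets[OF a] and Ib = local_ideal_max_meets[OF b]
      obtain a where a': "poly_vars a \<subseteq> atoms P \<inter> \<aa>" "q \<aa> = SR_coset k P \<aa> a"
        using q a by (rule SR_ring_coset)
      obtain b where b': "poly_vars b \<subseteq> atoms P \<inter> \<aa>" "r \<aa> = SR_coset k P \<aa> b"
        using r a by (rule SR_ring_coset)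
      have ops: "poly_vars (op a b) \<subseteq> atoms P \<inter> \<aa>"
        using op_vars[of a b] a' b' by blast
      have "q \<bb> = SR_coset k P \<bb> (restrict_poly \<bb> a)"
        using SR_ring_proj[OF q a b sub] SR_proj_coset[OF Ia Ib sub a'(1)] a'(2) by simp
      moreover have "r \<bb> = SR_coset k P \<bb> (restrict_poly \<bb> b)"
        using SR_ring_proj[OF r a b sub] SR_proj_coset[OF Ia Ib sub b'(1)] b'(2) by simp
      moreover have "poly_vars (restrict_poly \<bb> a) \<subseteq> atoms P \<inter> \<bb>"
        "poly_vars (restrict_poly \<bb> b) \<subseteq> atoms P \<inter> \<bb>"
        using poly_vars_restrict_poly[of \<bb> a] poly_vars_restrict_poly[of \<bb> b] a' b' by blast+
      ultimately have "s \<bb> = SR_coset k P \<bb> (restrict_poly \<bb> (op a b))"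
        unfolding op_res by (intro s[OF b])
      then show ?thesis
        using s[OF a a'(1) b'(1) a'(2) b'(2)] SR_proj_coset[OF Ia Ib sub ops] by simp
    qed
    show ?thesis
      using ext 1 2 by (auto simp: SR_ring_def PiE_def)
  qed
  show ?mult
    by (rule mem[of _ "(*)"], simp add: SR_ring_simps,
        simp add: SR_ring_simps local_SR_ring_ops local_ideal_max_meets,
        rule poly_vars_mult, rule restrict_poly_mult)
  show ?add
    by (rule mem[of _ "(+)"], simp add: SR_ring_simps,
        simp add: SR_ring_simps local_SR_ring_ops local_ideal_max_meets,
        rule poly_vars_add, rule restrict_poly_add)
qed

lemma SR_ring_one_closed: "\<one>\<^bsub>SR_ring k P\<^esub> \<in> carrier (SR_ring k P)"
proof -
  have "SR_coset k P \<aa> 1 \<in> carrier (local_SR_ring k P \<aa>)" for \<aa>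
    unfolding carrier_local_SR_ring by (rule imageI) simp
  moreover have "SR_proj k P \<bb> (SR_coset k P \<aa> 1) = SR_coset k P \<bb> 1"
    if "\<aa> \<in> max_meets P" "\<bb> \<in> max_meets P" "\<bb> \<subseteq> \<aa>" for \<aa> \<bb>
    using SR_proj_coset[OF local_ideal_max_meets[OF that(1)] local_ideal_max_meets[OF that(2)]
        that(3), of 1 k] by (simp add: restrict_poly_one)
  ultimately show ?thesis
    by (simp add: SR_ring_def local_SR_ring_one)
qed

text \<open>At the interval of a maximal element the classes are singletons, so operations on
  classes are operations on the polynomials themselves.\<close>

lemma max_part_ops:
  assumes q: "q \<in> carrier (SR_ring k P)" and r: "r \<in> carrier (SR_ring k P)"
  shows "max_part P (q \<otimes>\<^bsub>SR_ring k P\<^esub> r) = max_part P q \<otimes>\<^bsub>max_ring k P\<^esub> max_part P r"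
    and "max_part P (q \<oplus>\<^bsub>SR_ring k P\<^esub> r) = max_part P q \<oplus>\<^bsub>max_ring k P\<^esub> max_part P r"
proof -
  have "max_part P (q \<otimes>\<^bsub>SR_ring k P\<^esub> r) t = max_part P q t * max_part P r t"
    "max_part P (q \<oplus>\<^bsub>SR_ring k P\<^esub> r) t = max_part P q t + max_part P r t"
    if t: "t \<in> maximals P" for t
  proof -
    let ?a = "max_part P q t" and ?b = "max_part P r t"
    have vars: "poly_vars ?a \<subseteq> atoms P \<inter> below P t" "poly_vars ?b \<subseteq> atoms P \<inter> below P t"
      using poly_vars_max_part q r t by blast+
    have "poly_vars (?a * ?b) \<subseteq> atoms P \<inter> below P t" "poly_vars (?a + ?b) \<subseteq> atoms P \<inter> below P t"
      using vars poly_vars_mult[of ?a ?b] poly_vars_add[of ?a ?b] by blast+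
    note single = this[THEN SR_coset_below[OF maximals_carrier[OF t]]]
    have lhs: "max_part P s t = the_elem (s (below P t))" for s :: "'p set \<Rightarrow> ('p, 'a) mpoly set"
      using t by (simp add: max_part_def)
    note ops = local_SR_ring_ops[OF local_ideal_max_meets[OF below_in_max_meets[OF t]] vars]
    have "(q \<otimes>\<^bsub>SR_ring k P\<^esub> r) (below P t) = {?a * ?b}" "(q \<oplus>\<^bsub>SR_ring k P\<^esub> r) (below P t) = {?a + ?b}"
      by (simp_all add: SR_ring_simps below_in_max_meets[OF t] max_part_below[OF q t]
          max_part_below[OF r t] ops single)
    then show "max_part P (q \<otimes>\<^bsub>SR_ring k P\<^esub> r) t = ?a * ?b" "max_part P (q \<oplus>\<^bsub>SR_ring k P\<^esub> r) t = ?a + ?b"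
      unfolding lhs[of "q \<otimes>\<^bsub>SR_ring k P\<^esub> r"] lhs[of "q \<oplus>\<^bsub>SR_ring k P\<^esub> r"] by simp_all
  qed
  note pointwise = this
  have ext: "max_part P s \<in> extensional (maximals P)" for s :: "'p set \<Rightarrow> ('p, 'a) mpoly set"
    by (simp add: max_part_def)
  show "max_part P (q \<otimes>\<^bsub>SR_ring k P\<^esub> r) = max_part P q \<otimes>\<^bsub>max_ring k P\<^esub> max_part P r"
    by (rule extensionalityI[OF ext]) (simp_all add: max_ring_def pointwise(1))
  show "max_part P (q \<oplus>\<^bsub>SR_ring k P\<^esub> r) = max_part P q \<oplus>\<^bsub>max_ring k P\<^esub> max_part P r"
    by (rule extensionalityI[OF ext]) (simp_all add: max_ring_def pointwise(2))
qed

lemma max_part_one: "max_part P \<one>\<^bsub>SR_ring k P\<^esub> = \<one>\<^bsub>max_ring k P\<^esub>"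
  unfolding max_ring_def max_part_def SR_ring_simps local_SR_ring_one
  by (simp, rule restrict_ext) (simp add: below_in_max_meets SR_coset_below maximals_carrier)

lemma max_part_ring_iso: "max_part P \<in> ring_iso (SR_ring k P) (max_ring k P)"
  unfolding ring_iso_def
proof (intro CollectI conjI ring_hom_memI)
  show "bij_betw (max_part P) (carrier (SR_ring k P)) (carrier (max_ring k P))"
    using bij_betw_max_part by (simp add: max_ring_def)
  then show "max_part P q \<in> carrier (max_ring k P)" if "q \<in> carrier (SR_ring k P)" for q
    using that by (rule bij_betwE[rule_format])
qed (fact max_part_ops max_part_one)+

end

section \<open>Translative actions on simplicial posets\<close>

locale simplicial =
  fixes P :: "('p, 'm) gorder_scheme"
  assumes simplicial: "simplicial_poset P"
begin

lemma partial_order: "partial_order P"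
  using simplicial by (simp add: simplicial_poset_def)

lemma le_antisym: "\<lbrakk>x \<sqsubseteq>\<^bsub>P\<^esub> y; y \<sqsubseteq>\<^bsub>P\<^esub> x; x \<in> carrier P; y \<in> carrier P\<rbrakk> \<Longrightarrow> x = y"
  using partial_order.le_antisym[OF partial_order] by blast

lemma simplicial_refl: "x \<in> carrier P \<Longrightarrow> x \<sqsubseteq>\<^bsub>P\<^esub> x"
  by (rule weak_partial_order.le_refl[OF partial_order.axioms(1)[OF partial_order]])

lemma simplicial_trans:
  "\<lbrakk>x \<sqsubseteq>\<^bsub>P\<^esub> y; y \<sqsubseteq>\<^bsub>P\<^esub> z; x \<in> carrier P; y \<in> carrier P; z \<in> carrier P\<rbrakk> \<Longrightarrow> x \<sqsubseteq>\<^bsub>P\<^esub> z"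
  by (rule weak_partial_order.le_trans[OF partial_order.axioms(1)[OF partial_order]])

lemma zero_hat_unique: "z \<in> minimals P \<longleftrightarrow> z = zero_hat P"
proof -
  have "\<exists>!z. z \<in> minimals P" using simplicial by (simp add: simplicial_poset_def)
  from theI'[OF this] this show ?thesis unfolding zero_hat_def by blast
qed

lemma zero_hat_carrier: "zero_hat P \<in> carrier P"
  using zero_hat_unique[of "zero_hat P"] by (simp add: minimals_def)

lemma below_zero_hat: "x \<in> carrier P \<Longrightarrow> x \<sqsubseteq>\<^bsub>P\<^esub> zero_hat P \<Longrightarrow> x = zero_hat P"
  using zero_hat_unique[of "zero_hat P"] by (simp add: minimals_def)

lemma boolean_below:
  assumes "p \<in> carrier P"
  shows "boolean_lattice (P\<lparr>carrier := below P p\<rparr>)"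
  using simplicial assms by (simp add: simplicial_poset_def)

text \<open>A unique minimal element is not by definition a least one. The bottom of the Boolean
  lattice below p is minimal in all of P, hence equal to the unique minimal element.\<close>

lemma zero_hat_le:
  assumes "p \<in> carrier P"
  shows "zero_hat P \<sqsubseteq>\<^bsub>P\<^esub> p"
proof -
  let ?L = "P\<lparr>carrier := below P p\<rparr>"
  interpret L: bounded_lattice ?L
    using boolean_below[OF assms] by (simp add: boolean_lattice_def)
  have bot: "\<bottom>\<^bsub>?L\<^esub> \<in> carrier P" "\<bottom>\<^bsub>?L\<^esub> \<sqsubseteq>\<^bsub>P\<^esub> p"
    using L.bottom_closed by (simp_all add: below_def)
  have "\<bottom>\<^bsub>?L\<^esub> \<in> minimals P"
    unfolding minimals_def
  proof (intro CollectI conjI ballI impI bot)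
    fix y assume y: "y \<in> carrier P" "y \<sqsubseteq>\<^bsub>P\<^esub> \<bottom>\<^bsub>?L\<^esub>"
    then have "y \<in> below P p" using simplicial_trans[OF y(2) bot(2)] bot assms by (simp add: below_def)
    then have "\<bottom>\<^bsub>?L\<^esub> \<sqsubseteq>\<^bsub>P\<^esub> y" using L.bottom_lower[of y] by simp
    then show "y = \<bottom>\<^bsub>?L\<^esub>" using y bot le_antisym by blast
  qed
  then show ?thesis using bot by (simp add: zero_hat_unique)
qed

text \<open>An element with prescribed atoms arises as their join inside the interval of p, the
  atoms being adjoined one at a time. Distributivity ensures that no further atom lies below the
  join.\<close>

sublocale face_poset P
proof
  show "finite (below P p)" if "p \<in> carrier P" for p
    using simplicial that by (simp add: simplicial_poset_def)
  fix p S assume p: "p \<in> carrier P" and S: "S \<subseteq> {v \<in> atoms P. v \<sqsubseteq>\<^bsub>P\<^esub> p}"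
  have "finite {v \<in> atoms P. v \<sqsubseteq>\<^bsub>P\<^esub> p}"
    by (rule finite_subset[of _ "below P p"])
      (use simplicial p in \<open>auto simp: below_def atoms_carrier simplicial_poset_def\<close>)
  then have "finite S" by (rule finite_subset[OF S])
  let ?L = "P\<lparr>carrier := below P p\<rparr>"
  interpret L: bounded_lattice ?L
    using boolean_below[OF p] by (simp add: boolean_lattice_def)
  have distrib: "x \<sqinter>\<^bsub>?L\<^esub> (y \<squnion>\<^bsub>?L\<^esub> z) = (x \<sqinter>\<^bsub>?L\<^esub> y) \<squnion>\<^bsub>?L\<^esub> (x \<sqinter>\<^bsub>?L\<^esub> z)"
    if "x \<in> below P p" "y \<in> below P p" "z \<in> below P p" for x y z
    using boolean_below[OF p] that by (simp add: boolean_lattice_def)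
  have below_p: "x \<in> below P p" if "x \<sqsubseteq>\<^bsub>P\<^esub> y" "y \<in> below P p" "x \<in> carrier P" for x y
    using simplicial_trans[OF that(1)] that p by (auto simp: below_def)
  have "\<exists>x\<in>below P p. {v \<in> atoms P. v \<sqsubseteq>\<^bsub>P\<^esub> x} = S"
    using \<open>finite S\<close> S
  proof (induction S rule: finite_induct)
    case empty
    have "zero_hat P \<in> below P p"
      using p by (simp add: below_def zero_hat_carrier zero_hat_le)
    moreover have "{v \<in> atoms P. v \<sqsubseteq>\<^bsub>P\<^esub> zero_hat P} = {}"
      using below_zero_hat by (auto simp: atoms_def)
    ultimately show ?case by blast
  next
    case (insert s S)
    then obtain x where x: "x \<in> below P p" "{v \<in> atoms P. v \<sqsubseteq>\<^bsub>P\<^esub> x} = S" by blast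
    have s: "s \<in> atoms P" "s \<in> below P p"
      using insert.prems by (auto simp: below_def atoms_carrier)
    let ?j = "x \<squnion>\<^bsub>?L\<^esub> s"
    have j: "?j \<in> below P p" using L.join_closed[of x s] x s by simp
    have xj: "x \<sqsubseteq>\<^bsub>P\<^esub> ?j" "s \<sqsubseteq>\<^bsub>P\<^esub> ?j"
      using L.join_left[of x s] L.join_right[of x s] x s by simp_all
    have "{v \<in> atoms P. v \<sqsubseteq>\<^bsub>P\<^esub> ?j} = insert s S"
    proof (intro equalityI subsetI)
      fix v assume "v \<in> {v \<in> atoms P. v \<sqsubseteq>\<^bsub>P\<^esub> ?j}"
      then have v: "v \<in> atoms P" "v \<sqsubseteq>\<^bsub>P\<^esub> ?j" by auto
      then have vp: "v \<in> below P p" using below_p[OF v(2) j] by (simp add: atoms_carrier)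
      \<comment> \<open>The meet lies below the atom v, so it is the minimal element or v
        itself.\<close>
      have meet_v: "v \<sqinter>\<^bsub>?L\<^esub> y \<in> {zero_hat P, v}" if "y \<in> below P p" for y
      proof -
        have "v \<sqinter>\<^bsub>?L\<^esub> y \<sqsubseteq>\<^bsub>P\<^esub> v" "v \<sqinter>\<^bsub>?L\<^esub> y \<in> carrier P"
          using L.meet_left[of v y] L.meet_closed[of v y] vp that by (simp_all add: below_def)
        then show ?thesis using v(1) by (auto simp: atoms_def)
      qed
      have "v = v \<sqinter>\<^bsub>?L\<^esub> ?j"
        using L.le_iff_join[of v ?j] v(2) vp j by simp
      also have "\<dots> = (v \<sqinter>\<^bsub>?L\<^esub> x) \<squnion>\<^bsub>?L\<^esub> (v \<sqinter>\<^bsub>?L\<^esub> s)"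
        using distrib vp x s by simp
      finally have v_eq: "v = (v \<sqinter>\<^bsub>?L\<^esub> x) \<squnion>\<^bsub>?L\<^esub> (v \<sqinter>\<^bsub>?L\<^esub> s)" .
      have "v \<sqinter>\<^bsub>?L\<^esub> x = v \<or> v \<sqinter>\<^bsub>?L\<^esub> s = v"
      \<comment> \<open>Otherwise v would be the join of two copies of the minimal element, hence
        minimal, whereas an atom is not.\<close>
      proof (rule ccontr)
        assume "\<not> ?thesis"
        then have "v \<sqinter>\<^bsub>?L\<^esub> x = zero_hat P" "v \<sqinter>\<^bsub>?L\<^esub> s = zero_hat P"
          using meet_v x s by auto
        then have "v = zero_hat P \<squnion>\<^bsub>?L\<^esub> zero_hat P" using v_eq by simp
        moreover have "zero_hat P \<in> below P p"
          using p by (simp add: below_def zero_hat_carrier zero_hat_le)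
        then have "zero_hat P \<squnion>\<^bsub>?L\<^esub> zero_hat P \<sqsubseteq>\<^bsub>P\<^esub> zero_hat P"
          using L.join_le[of "zero_hat P" "zero_hat P" "zero_hat P"] by (simp add: simplicial_refl zero_hat_carrier)
        ultimately show False
          using v(1) below_zero_hat[of v] by (simp add: atoms_def)
      qed
      then show "v \<in> insert s S"
      proof
        assume "v \<sqinter>\<^bsub>?L\<^esub> x = v"
        then have "v \<sqsubseteq>\<^bsub>P\<^esub> x" using L.meet_right[of v x] vp x by simp
        then show ?thesis using v x by blast
      next
        assume "v \<sqinter>\<^bsub>?L\<^esub> s = v"
        then have "v \<sqsubseteq>\<^bsub>P\<^esub> s" using L.meet_right[of v s] vp s by simp
        then show ?thesis using v(1) s(1) by (auto simp: atoms_def)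
      qed
    next
      fix v assume v: "v \<in> insert s S"
      then show "v \<in> {v \<in> atoms P. v \<sqsubseteq>\<^bsub>P\<^esub> ?j}"
      proof
        assume "v \<in> S"
        then have "v \<in> atoms P" "v \<sqsubseteq>\<^bsub>P\<^esub> x" using x by auto
        then show ?thesis
          using simplicial_trans[OF _ xj(1), of v] x j by (simp add: below_def atoms_carrier)
      qed (use xj s in simp)
    qed
    then show ?case using j by blast
  qed
  then show "\<exists>x\<in>carrier P. x \<sqsubseteq>\<^bsub>P\<^esub> p \<and> {v \<in> atoms P. v \<sqsubseteq>\<^bsub>P\<^esub> x} = S"
    by (auto simp: below_def)
qed (fact simplicial_refl simplicial_trans)+

end

section \<open>The orbit map on lower intervals\<close>

locale translative_action = simplicial P
  for P :: "('p, 'm) gorder_scheme" +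
  fixes G :: "('g, 'n) monoid_scheme" and \<phi> :: "'g \<Rightarrow> 'p \<Rightarrow> 'p"
  assumes group: "group G"
    and poset_action: "poset_action G P \<phi>"
    and translative: "translative G P \<phi>"
begin

sublocale G: group G by (rule group)

sublocale act: group_action G "carrier P" \<phi>
  using poset_action by (simp add: poset_action_def)

lemma act_closed: "g \<in> carrier G \<Longrightarrow> x \<in> carrier P \<Longrightarrow> \<phi> g x \<in> carrier P"
  using act.element_image by blast

lemma act_le_iff:
  "\<lbrakk>g \<in> carrier G; x \<in> carrier P; y \<in> carrier P\<rbrakk> \<Longrightarrow> \<phi> g x \<sqsubseteq>\<^bsub>P\<^esub> \<phi> g y \<longleftrightarrow> x \<sqsubseteq>\<^bsub>P\<^esub> y"
  using poset_action by (simp add: poset_action_def)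

lemma act_inv:
  assumes "g \<in> carrier G" "x \<in> carrier P"
  shows "\<phi> (inv\<^bsub>G\<^esub> g) (\<phi> g x) = x" "\<phi> g (\<phi> (inv\<^bsub>G\<^esub> g) x) = x"
  using act.orbit_sym_aux[OF assms HOL.refl] act.orbit_sym_aux[OF G.inv_closed[OF assms(1)] assms(2) HOL.refl]
    assms by simp_all

lemma act_le_shift:
  assumes "g \<in> carrier G" "x \<in> carrier P" "y \<in> carrier P"
  shows "\<phi> g x \<sqsubseteq>\<^bsub>P\<^esub> y \<longleftrightarrow> x \<sqsubseteq>\<^bsub>P\<^esub> \<phi> (inv\<^bsub>G\<^esub> g) y"
  using act_le_iff[of g x "\<phi> (inv\<^bsub>G\<^esub> g) y"] assms by (simp add: act_inv act_closed)

lemma act_bounded: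
  assumes "g \<in> carrier G" "x \<in> carrier P" "u \<in> carrier P" "x \<sqsubseteq>\<^bsub>P\<^esub> u" "\<phi> g x \<sqsubseteq>\<^bsub>P\<^esub> u"
  shows "\<phi> g x = x"
  using translative assms unfolding translative_def by metis

abbreviation orb :: "'p \<Rightarrow> 'p set" where "orb \<equiv> orbit G \<phi>"

abbreviation Q :: "'p set gorder" where "Q \<equiv> quotient_poset G P \<phi>"

lemma carrier_Q: "carrier Q = orb ` carrier P"
  by (auto simp: quotient_poset_def orbits_def)

lemma act_one: "x \<in> carrier P \<Longrightarrow> \<phi> \<one>\<^bsub>G\<^esub> x = x"
  using act.id_eq_one by (metis restrict_apply')

lemma act_mult:
  "\<lbrakk>g \<in> carrier G; h \<in> carrier G; x \<in> carrier P\<rbrakk> \<Longrightarrow> \<phi> g (\<phi> h x) = \<phi> (g \<otimes>\<^bsub>G\<^esub> h) x"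
  by (rule act.composition_rule[symmetric])

lemma orb_act:
  assumes "g \<in> carrier G" "x \<in> carrier P"
  shows "orb (\<phi> g x) = orb x"
proof (intro equalityI subsetI)
  fix y assume "y \<in> orb (\<phi> g x)"
  then obtain h where "h \<in> carrier G" "y = \<phi> (h \<otimes>\<^bsub>G\<^esub> g) x"
    using assms by (auto simp: orbit_def act_mult)
  then show "y \<in> orb x" using assms by (auto simp: orbit_def)
next
  fix y assume "y \<in> orb x"
  then obtain h where h: "h \<in> carrier G" "y = \<phi> h x" by (auto simp: orbit_def)
  then have "y = \<phi> (h \<otimes>\<^bsub>G\<^esub> inv\<^bsub>G\<^esub> g) (\<phi> g x)"
    using assms act_mult[of h "inv\<^bsub>G\<^esub> g" "\<phi> g x"] by (simp add: act_inv act_closed)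
  then show "y \<in> orb (\<phi> g x)" using h assms by (auto simp: orbit_def)
qed

lemma orb_eq_iff:
  assumes "x \<in> carrier P" "y \<in> carrier P"
  shows "orb x = orb y \<longleftrightarrow> (\<exists>g\<in>carrier G. \<phi> g x = y)"
proof
  assume "orb x = orb y"
  then have "y \<in> orb x" using act.orbit_refl[OF assms(2)] by simp
  then show "\<exists>g\<in>carrier G. \<phi> g x = y" by (auto simp: orbit_def)
qed (use assms orb_act in auto)

text \<open>The order on orbits asks for some pair of representatives. The group elements can all be
  moved to one side, so the relation is decided with x and y fixed.\<close>

lemma le_Q_iff:
  assumes "x \<in> carrier P" "y \<in> carrier P"
  shows "orb x \<sqsubseteq>\<^bsub>Q\<^esub> orb y \<longleftrightarrow> (\<exists>g\<in>carrier G. \<phi> g x \<sqsubseteq>\<^bsub>P\<^esub> y)"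
proof
  assume "orb x \<sqsubseteq>\<^bsub>Q\<^esub> orb y"
  then obtain g h l where ghl: "g \<in> carrier G" "h \<in> carrier G" "l \<in> carrier G"
      "\<phi> g (\<phi> h x) \<sqsubseteq>\<^bsub>P\<^esub> \<phi> l y"
    by (auto simp: quotient_poset_def orbit_def)
  then have "\<phi> (inv\<^bsub>G\<^esub> l) (\<phi> g (\<phi> h x)) \<sqsubseteq>\<^bsub>P\<^esub> y"
    using assms act_le_shift[of "inv\<^bsub>G\<^esub> l" "\<phi> g (\<phi> h x)" y] by (simp add: act_closed)
  moreover have "\<phi> (inv\<^bsub>G\<^esub> l) (\<phi> g (\<phi> h x)) = \<phi> (inv\<^bsub>G\<^esub> l \<otimes>\<^bsub>G\<^esub> (g \<otimes>\<^bsub>G\<^esub> h)) x"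
    using ghl assms by (simp add: act_mult act_closed)
  ultimately show "\<exists>g\<in>carrier G. \<phi> g x \<sqsubseteq>\<^bsub>P\<^esub> y"
    using ghl by (intro bexI[of _ "inv\<^bsub>G\<^esub> l \<otimes>\<^bsub>G\<^esub> (g \<otimes>\<^bsub>G\<^esub> h)"]) auto
next
  assume "\<exists>g\<in>carrier G. \<phi> g x \<sqsubseteq>\<^bsub>P\<^esub> y"
  then show "orb x \<sqsubseteq>\<^bsub>Q\<^esub> orb y"
    using act.orbit_refl assms by (auto simp: quotient_poset_def)
qed

lemma orb_mono: "\<lbrakk>x \<sqsubseteq>\<^bsub>P\<^esub> y; x \<in> carrier P; y \<in> carrier P\<rbrakk> \<Longrightarrow> orb x \<sqsubseteq>\<^bsub>Q\<^esub> orb y"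
  using le_Q_iff G.one_closed act_one by metis

text \<open>The only place where translativity enters: if y = gx and both lie below p, then x = y.
  Together with \<open>below_Q\<close> this makes the orbit map a bijection between lower
  intervals.\<close>

lemma inj_on_orb_below:
  assumes "p \<in> carrier P"
  shows "inj_on orb (below P p)"
proof (rule inj_onI)
  fix x y assume x: "x \<in> below P p" and y: "y \<in> below P p" and eq: "orb x = orb y"
  then obtain g where g: "g \<in> carrier G" "\<phi> g x = y"
    using orb_eq_iff by (auto simp: below_def)
  then show "x = y"
    using act_bounded[OF g(1), of x p] x y assms by (simp add: below_def)
qed

text \<open>A representative of X is moved by the group until it lies below the given y; relations
  in P/G are lifted downward from a fixed upper element.\<close>

lemma le_QE:
  assumes "X \<sqsubseteq>\<^bsub>Q\<^esub> orb y" "X \<in> carrier Q" "y \<in> carrier P"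
  obtains x where "x \<in> carrier P" "x \<sqsubseteq>\<^bsub>P\<^esub> y" "X = orb x"
proof -
  obtain x where x: "x \<in> carrier P" "X = orb x" using assms(2) by (auto simp: carrier_Q)
  then obtain g where g: "g \<in> carrier G" "\<phi> g x \<sqsubseteq>\<^bsub>P\<^esub> y"
    using assms by (auto simp: le_Q_iff)
  show thesis
    by (rule that[of "\<phi> g x"]) (use x g in \<open>simp_all add: act_closed orb_act\<close>)
qed

lemma below_Q:
  assumes "p \<in> carrier P"
  shows "below Q (orb p) = orb ` below P p"
proof (intro equalityI subsetI)
  fix X assume "X \<in> below Q (orb p)"
  then obtain x where "x \<in> carrier P" "x \<sqsubseteq>\<^bsub>P\<^esub> p" "X = orb x"
    using le_QE[of X p] assms by (auto simp: below_def)
  then show "X \<in> orb ` below P p" by (auto simp: below_def)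
next
  fix X assume "X \<in> orb ` below P p"
  then show "X \<in> below Q (orb p)"
    using assms orb_mono by (auto simp: below_def carrier_Q)
qed

lemma zero_hat_Q: "zero_hat Q = orb (zero_hat P)"
  unfolding zero_hat_def[of Q]
proof (rule the_equality)
  show "orb (zero_hat P) \<in> minimals Q"
    unfolding minimals_def
  proof (intro CollectI conjI ballI impI)
    fix X assume "X \<in> carrier Q" "X \<sqsubseteq>\<^bsub>Q\<^esub> orb (zero_hat P)"
    then obtain x where "x \<in> carrier P" "x \<sqsubseteq>\<^bsub>P\<^esub> zero_hat P" "X = orb x"
      using le_QE zero_hat_carrier by blast
    then show "X = orb (zero_hat P)" using below_zero_hat by blast
  qed (simp add: carrier_Q zero_hat_carrier)
next
  fix Z assume Z: "Z \<in> minimals Q"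
  then obtain z where z: "z \<in> carrier P" "Z = orb z" by (auto simp: minimals_def carrier_Q)
  then have "orb (zero_hat P) \<sqsubseteq>\<^bsub>Q\<^esub> Z" by (auto intro: orb_mono zero_hat_le zero_hat_carrier)
  then have "orb (zero_hat P) = Z"
    using Z zero_hat_carrier by (auto simp: minimals_def carrier_Q)
  then show "Z = orb (zero_hat P)" ..
qed

text \<open>Being an atom concerns only the interval below v, and the orbit map identifies it with
  the interval below \<open>orb v\<close>.\<close>

lemma atoms_Q_iff:
  assumes "v \<in> carrier P"
  shows "orb v \<in> atoms Q \<longleftrightarrow> v \<in> atoms P"
proof -
  \<comment> \<open>Both x and the minimal element lie below x, so injectivity on the interval of x
    separates their orbits.\<close>
  have zero: "orb x = orb (zero_hat P) \<longleftrightarrow> x = zero_hat P" if "x \<in> carrier P" for x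
    using inj_on_orb_below[OF that] that zero_hat_le le_refl zero_hat_carrier
    by (auto simp: inj_on_def below_def)
  have eq: "orb x = orb v \<longleftrightarrow> x = v" if "x \<in> carrier P" "x \<sqsubseteq>\<^bsub>P\<^esub> v" for x
    using inj_on_orb_below[OF assms] that assms le_refl by (auto simp: inj_on_def below_def)
  have "(\<forall>Y\<in>carrier Q. Y \<sqsubseteq>\<^bsub>Q\<^esub> orb v \<longrightarrow> Y = zero_hat Q \<or> Y = orb v) \<longleftrightarrow>
      (\<forall>Y\<in>below Q (orb v). Y = zero_hat Q \<or> Y = orb v)"
    by (auto simp: below_def)
  also have "\<dots> \<longleftrightarrow> (\<forall>y\<in>carrier P. y \<sqsubseteq>\<^bsub>P\<^esub> v \<longrightarrow> y = zero_hat P \<or> y = v)"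
    unfolding below_Q[OF assms] using zero eq by (auto simp: below_def zero_hat_Q)
  finally show ?thesis
    using assms zero[OF assms] by (simp add: atoms_def zero_hat_Q carrier_Q)
qed

lemma act_maximals:
  assumes "g \<in> carrier G" "t \<in> maximals P"
  shows "\<phi> g t \<in> maximals P"
  unfolding maximals_def
proof (intro CollectI conjI ballI impI)
  have t: "t \<in> carrier P" using assms(2) by (rule maximals_carrier)
  then show "\<phi> g t \<in> carrier P" using assms(1) act_closed by blast
  fix y assume y: "y \<in> carrier P" "\<phi> g t \<sqsubseteq>\<^bsub>P\<^esub> y"
  then have "\<phi> (inv\<^bsub>G\<^esub> g) y = t"
    using assms t by (auto simp: act_le_shift maximals_def act_closed)
  then show "y = \<phi> g t" using act_inv(2)[OF assms(1) y(1)] by simp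
qed

text \<open>If t is maximal, so are its translates, and an orbit above \<open>orb t\<close> has a
  representative above some gt, hence equal to it. Conversely, if y lies above t and has the same
  orbit, then t and y are both in the interval of y, where the orbit map is injective.\<close>

lemma maximals_Q_iff:
  assumes "t \<in> carrier P"
  shows "orb t \<in> maximals Q \<longleftrightarrow> t \<in> maximals P"
proof
  assume t: "t \<in> maximals P"
  show "orb t \<in> maximals Q"
    unfolding maximals_def
  proof (intro CollectI conjI ballI impI)
    fix Y assume "Y \<in> carrier Q" "orb t \<sqsubseteq>\<^bsub>Q\<^esub> Y"
    then obtain y g where "y \<in> carrier P" "Y = orb y" "g \<in> carrier G" "\<phi> g t \<sqsubseteq>\<^bsub>P\<^esub> y"
      using assms by (auto simp: carrier_Q le_Q_iff)
    moreover from this have "y = \<phi> g t" using act_maximals[OF _ t] by (simp add: maximals_def)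
    ultimately show "Y = orb t" using assms by (simp add: orb_act)
  qed (use assms in \<open>simp add: carrier_Q\<close>)
next
  assume t: "orb t \<in> maximals Q"
  show "t \<in> maximals P"
    unfolding maximals_def
  proof (intro CollectI conjI ballI impI assms)
    fix y assume y: "y \<in> carrier P" "t \<sqsubseteq>\<^bsub>P\<^esub> y"
    then have "orb t \<sqsubseteq>\<^bsub>Q\<^esub> orb y" using assms by (intro orb_mono)
    then have "orb y = orb t" using t y(1) by (auto simp: maximals_def carrier_Q)
    then show "y = t"
      using inj_on_orb_below[OF y(1)] y assms le_refl by (auto simp: inj_on_def below_def)
  qed
qed

lemma maximals_Q: "maximals Q = orb ` maximals P"
proof -
  have "maximals Q \<subseteq> orb ` carrier P" using maximals_carrier[of _ Q] by (auto simp: carrier_Q)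
  then show ?thesis using maximals_Q_iff maximals_carrier[of _ P] by blast
qed

lemma atoms_below_Q:
  assumes "p \<in> carrier P"
  shows "{V \<in> atoms Q. V \<sqsubseteq>\<^bsub>Q\<^esub> orb p} = orb ` {v \<in> atoms P. v \<sqsubseteq>\<^bsub>P\<^esub> p}"
proof -
  have "{V \<in> atoms Q. V \<sqsubseteq>\<^bsub>Q\<^esub> orb p} = below Q (orb p) \<inter> atoms Q"
    by (auto simp: below_def atoms_carrier)
  also have "\<dots> = orb ` (below P p \<inter> atoms P)"
    unfolding below_Q[OF assms] using atoms_Q_iff by (auto simp: below_def)
  also have "below P p \<inter> atoms P = {v \<in> atoms P. v \<sqsubseteq>\<^bsub>P\<^esub> p}"
    by (auto simp: below_def atoms_carrier)
  finally show ?thesis .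
qed

text \<open>Each property is lifted to the interval of one representative in P and pushed down again
  along the orbit map.\<close>

sublocale Q: face_poset Q
proof
  fix X assume "X \<in> carrier Q"
  then show "X \<sqsubseteq>\<^bsub>Q\<^esub> X" by (auto simp: carrier_Q intro: orb_mono le_refl)
next
  fix X Y Z assume XY: "X \<sqsubseteq>\<^bsub>Q\<^esub> Y" "Y \<sqsubseteq>\<^bsub>Q\<^esub> Z" and X: "X \<in> carrier Q" and Y: "Y \<in> carrier Q"
    and Z: "Z \<in> carrier Q"
  \<comment> \<open>The representatives are chosen from the top down, each below the previous one,
    so that they form a chain in P.\<close>
  obtain z where z: "z \<in> carrier P" "Z = orb z" using Z by (auto simp: carrier_Q)
  obtain y where y: "y \<in> carrier P" "y \<sqsubseteq>\<^bsub>P\<^esub> z" "Y = orb y"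
    using le_QE XY(2) Y z by blast
  obtain x where x: "x \<in> carrier P" "x \<sqsubseteq>\<^bsub>P\<^esub> y" "X = orb x"
    using le_QE XY(1) X y by blast
  have "x \<sqsubseteq>\<^bsub>P\<^esub> z" by (rule le_trans[OF x(2) y(2)]) fact+
  then show "X \<sqsubseteq>\<^bsub>Q\<^esub> Z" using x z by (auto intro: orb_mono)
next
  fix p assume "p \<in> carrier Q"
  then show "finite (below Q p)" by (auto simp: carrier_Q below_Q finite_below)
next
  fix X S assume "X \<in> carrier Q" and S: "S \<subseteq> {V \<in> atoms Q. V \<sqsubseteq>\<^bsub>Q\<^esub> X}"
  then obtain p where p: "p \<in> carrier P" "X = orb p" by (auto simp: carrier_Q)
  then have S': "S \<subseteq> orb ` {v \<in> atoms P. v \<sqsubseteq>\<^bsub>P\<^esub> p}" using S atoms_below_Q by simp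
  then obtain T where T: "T \<subseteq> {v \<in> atoms P. v \<sqsubseteq>\<^bsub>P\<^esub> p}" "S = orb ` T"
    by (auto simp: subset_image_iff)
  obtain x where "x \<in> carrier P" "x \<sqsubseteq>\<^bsub>P\<^esub> p" "{v \<in> atoms P. v \<sqsubseteq>\<^bsub>P\<^esub> x} = T"
    using subface_exists[OF p(1) T(1)] by blast
  then show "\<exists>Y\<in>carrier Q. Y \<sqsubseteq>\<^bsub>Q\<^esub> X \<and> {V \<in> atoms Q. V \<sqsubseteq>\<^bsub>Q\<^esub> Y} = S"
    using p T(2) by (intro bexI[of _ "orb x"]) (auto simp: atoms_below_Q carrier_Q orb_mono)
qed

section \<open>Invariants\<close>

lemma act_inj_on: "g \<in> carrier G \<Longrightarrow> inj_on (\<phi> g) (carrier P)"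
  by (rule act.inj_prop)

text \<open>v and gv have the same orbit, and being an atom can be read off the orbit.\<close>

lemma act_atoms:
  assumes "g \<in> carrier G" "v \<in> carrier P"
  shows "\<phi> g v \<in> atoms P \<longleftrightarrow> v \<in> atoms P"
  using atoms_Q_iff[of v] atoms_Q_iff[of "\<phi> g v"] assms by (simp add: orb_act act_closed)

lemma act_atoms_below:
  assumes "g \<in> carrier G" "x \<in> carrier P"
  shows "{v \<in> atoms P. v \<sqsubseteq>\<^bsub>P\<^esub> \<phi> g x} = \<phi> g ` {v \<in> atoms P. v \<sqsubseteq>\<^bsub>P\<^esub> x}"
proof (intro equalityI subsetI)
  fix v assume v: "v \<in> {v \<in> atoms P. v \<sqsubseteq>\<^bsub>P\<^esub> \<phi> g x}"
  let ?w = "\<phi> (inv\<^bsub>G\<^esub> g) v"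
  have "v \<in> carrier P" using v atoms_carrier by auto
  then have "?w \<in> atoms P" "?w \<sqsubseteq>\<^bsub>P\<^esub> x" "v = \<phi> g ?w"
    using v assms by (simp_all add: act_atoms act_le_shift act_inv)
  then show "v \<in> \<phi> g ` {v \<in> atoms P. v \<sqsubseteq>\<^bsub>P\<^esub> x}" by blast
qed (use assms atoms_carrier[of _ P] in \<open>auto simp: act_atoms act_le_iff\<close>)

lemma act_below:
  assumes "g \<in> carrier G" "x \<in> carrier P"
  shows "\<phi> g ` below P x = below P (\<phi> g x)"
proof (intro equalityI subsetI)
  fix y assume y: "y \<in> below P (\<phi> g x)"
  let ?z = "\<phi> (inv\<^bsub>G\<^esub> g) y"
  have "?z \<in> below P x" "y = \<phi> g ?z"
    using y assms by (simp_all add: below_def act_le_shift act_inv act_closed)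
  then show "y \<in> \<phi> g ` below P x" by blast
qed (use assms in \<open>auto simp: below_def act_closed act_le_iff\<close>)

lemma act_face_sets:
  assumes "g \<in> carrier G" "\<aa> \<subseteq> carrier P"
  shows "face_sets P (\<phi> g ` \<aa>) = (`) (\<phi> g) ` face_sets P \<aa>"
proof -
  have "face_sets P (\<phi> g ` \<aa>) = (\<lambda>x. {v \<in> atoms P. v \<sqsubseteq>\<^bsub>P\<^esub> \<phi> g x}) ` \<aa>"
    by (auto simp: face_sets_def)
  also have "\<dots> = (\<lambda>x. \<phi> g ` {v \<in> atoms P. v \<sqsubseteq>\<^bsub>P\<^esub> x}) ` \<aa>"
    by (intro image_cong refl act_atoms_below) (use assms in auto)
  also have "\<dots> = (`) (\<phi> g) ` face_sets P \<aa>"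
    by (auto simp: face_sets_def)
  finally show ?thesis .
qed

text \<open>Taking images under an injective map commutes with intersections, and translates of
  maximal elements are maximal.\<close>

lemma act_max_meets:
  assumes "g \<in> carrier G" "\<aa> \<in> max_meets P"
  shows "\<phi> g ` \<aa> \<in> max_meets P"
proof -
  obtain \<tau> where \<tau>: "\<tau> \<noteq> {}" "\<tau> \<subseteq> maximals P" "\<aa> = (\<Inter>t\<in>\<tau>. below P t)"
    using assms(2) by (auto simp: max_meets_def)
  then obtain t where "t \<in> \<tau>" by auto
  have "\<phi> g ` \<aa> = (\<Inter>t\<in>\<tau>. \<phi> g ` below P t)"
    unfolding \<tau>(3)
    by (rule image_INT[OF act_inj_on[OF assms(1)] _ \<open>t \<in> \<tau>\<close>]) (auto simp: below_def)
  also have "\<dots> = (\<Inter>t\<in>\<tau>. below P (\<phi> g t))"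
    using \<tau>(2) act_below[OF assms(1)] maximals_carrier[of _ P] by (intro INF_cong) auto
  also have "\<dots> = (\<Inter>t\<in>\<phi> g ` \<tau>. below P t)" by simp
  finally show ?thesis
    unfolding max_meets_def using \<tau> act_maximals[OF assms(1)]
    by (intro CollectI exI[of _ "\<phi> g ` \<tau>"]) auto
qed

lemma act_image_inv:
  assumes "g \<in> carrier G" "\<aa> \<subseteq> carrier P"
  shows "\<phi> g ` \<phi> (inv\<^bsub>G\<^esub> g) ` \<aa> = \<aa>"
proof -
  have "(\<lambda>x. \<phi> g (\<phi> (inv\<^bsub>G\<^esub> g) x)) ` \<aa> = (\<lambda>x. x) ` \<aa>"
    by (rule image_cong) (use assms in \<open>auto simp: act_inv\<close>)
  then show ?thesis by (simp add: image_image)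
qed

lemma act_vars:
  assumes "g \<in> carrier G" "\<aa> \<subseteq> carrier P" "poly_vars p \<subseteq> atoms P \<inter> \<aa>"
  shows "poly_vars (rename_poly (\<phi> g) p) \<subseteq> atoms P \<inter> \<phi> g ` \<aa>"
proof -
  have "\<phi> g ` (atoms P \<inter> \<aa>) \<subseteq> atoms P \<inter> \<phi> g ` \<aa>"
    using assms(1,2) act_atoms by auto
  then show ?thesis
    using poly_vars_rename_poly[of "\<phi> g" p] assms(3) by blast
qed

text \<open>The witness is m renamed by the inverse of g; its support is the face of
  \<open>\<aa>\<close> that g carries to the support of m.\<close>

lemma act_face_monomE:
  assumes "g \<in> carrier G" "local_ideal P \<aa>" "Poly_Mapping.keys m \<in> face_sets P (\<phi> g ` \<aa>)"
  obtains n where "m = rename_monom (\<phi> g) n" "Poly_Mapping.keys n \<in> face_sets P \<aa>"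
proof -
  note a = local_ideal_carrier[OF assms(2)]
  obtain S where S: "S \<in> face_sets P \<aa>" "Poly_Mapping.keys m = \<phi> g ` S"
    using assms(3) by (auto simp: act_face_sets[OF assms(1) a])
  have SP: "S \<subseteq> carrier P" using face_sets_subset[OF assms(2) S(1)] a by blast
  let ?n = "rename_monom (\<phi> (inv\<^bsub>G\<^esub> g)) m"
  have "Poly_Mapping.keys ?n = (\<lambda>x. x) ` S"
    unfolding keys_rename_monom S(2) image_image
    by (rule image_cong) (use SP assms(1) in \<open>auto simp: act_inv\<close>)
  moreover have "rename_monom (\<phi> g) ?n = m"
    unfolding rename_monom_compose
    by (rule rename_monom_id) (use S(2) SP assms(1) in \<open>auto simp: act_inv act_closed\<close>)
  ultimately show thesis using that[of ?n] S(1) by simp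
qed

lemma lookup_rename_act:
  assumes "g \<in> carrier G" "local_ideal P \<aa>" "poly_vars p \<subseteq> carrier P" "Poly_Mapping.keys n \<in> face_sets P \<aa>"
  shows "Poly_Mapping.lookup (rename_poly (\<phi> g) p) (rename_monom (\<phi> g) n) = Poly_Mapping.lookup p n"
  by (rule lookup_rename_poly[OF act_inj_on[OF assms(1)] assms(3)])
    (use face_sets_subset[OF assms(2,4)] local_ideal_carrier[OF assms(2)] in blast)

lemma act_local_ideal:
  assumes "g \<in> carrier G" "\<aa> \<in> max_meets P"
  shows "local_ideal P (\<phi> g ` \<aa>)"
  by (rule local_ideal_max_meets[OF act_max_meets[OF assms]])

text \<open>Every face monomial of the translated ideal is a renamed face monomial of
  \<open>\<aa>\<close>, with the same coefficient, so the class of the result depends only on the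
  class of p.\<close>

lemma SR_omega_coset:
  assumes g: "g \<in> carrier G" and a: "\<aa> \<in> max_meets P" and p: "poly_vars p \<subseteq> atoms P \<inter> \<aa>"
  shows "SR_omega k P \<phi> g \<aa> (SR_coset k P \<aa> p) = SR_coset k P (\<phi> g ` \<aa>) (rename_poly (\<phi> g) p)"
  unfolding SR_omega_def rename_poly_def[symmetric]
proof (rule quot_map_coset[OF local_ideal_max_meets[OF a] p])
  note I = local_ideal_max_meets[OF a]
  note aP = local_ideal_carrier[OF I]
  fix q assume "q \<in> SR_coset k P \<aa> p"
  then have q: "poly_vars q \<subseteq> atoms P \<inter> \<aa>"
    and eq: "\<And>m. Poly_Mapping.keys m \<in> face_sets P \<aa> \<Longrightarrow> Poly_Mapping.lookup q m = Poly_Mapping.lookup p m"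
    by (auto simp: SR_coset_eq[OF I p])
  have vars: "poly_vars p \<subseteq> carrier P" "poly_vars q \<subseteq> carrier P" using p q aP by auto
  show "SR_coset k P (\<phi> g ` \<aa>) (rename_poly (\<phi> g) q) = SR_coset k P (\<phi> g ` \<aa>) (rename_poly (\<phi> g) p)"
  proof (subst SR_coset_eq_iff[OF act_local_ideal[OF g a] act_vars[OF g aP q] act_vars[OF g aP p]],
      intro allI impI)
    fix m :: "'p \<Rightarrow>\<^sub>0 nat" assume "Poly_Mapping.keys m \<in> face_sets P (\<phi> g ` \<aa>)"
    then obtain n where n: "m = rename_monom (\<phi> g) n" "Poly_Mapping.keys n \<in> face_sets P \<aa>"
      by (rule act_face_monomE[OF g I])
    show "Poly_Mapping.lookup (rename_poly (\<phi> g) q) m = Poly_Mapping.lookup (rename_poly (\<phi> g) p) m"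
      using lookup_rename_act[OF g I vars(1) n(2)] lookup_rename_act[OF g I vars(2) n(2)] eq[OF n(2)]
      by (simp add: n(1))
  qed
qed

definition equivariant :: "('p \<Rightarrow> ('p, 'k::field) mpoly) \<Rightarrow> bool" where
  "equivariant f \<longleftrightarrow> (\<forall>g\<in>carrier G. \<forall>t\<in>maximals P. f (\<phi> g t) = rename_poly (\<phi> g) (f t))"

lemma SR_action_below:
  assumes q: "q \<in> carrier (SR_ring k P)" and g: "g \<in> carrier G" and t: "t \<in> maximals P"
  shows "SR_action k G P \<phi> g q (below P (\<phi> g t)) = {rename_poly (\<phi> g) (max_part P q t)}"
proof -
  note tP = maximals_carrier[OF t]
  note gt = act_maximals[OF g t]
  have inv: "\<phi> (inv\<^bsub>G\<^esub> g) ` below P (\<phi> g t) = below P t"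
    using act_below[of "inv\<^bsub>G\<^esub> g" "\<phi> g t"] g tP by (simp add: act_closed act_inv)
  note vars = poly_vars_max_part[OF q t]
  have "SR_action k G P \<phi> g q (below P (\<phi> g t)) = SR_omega k P \<phi> g (below P t) (q (below P t))"
    by (simp add: SR_action_def below_in_max_meets[OF gt] inv)
  also have "\<dots> = SR_coset k P (below P (\<phi> g t)) (rename_poly (\<phi> g) (max_part P q t))"
    unfolding max_part_below[OF q t] SR_omega_coset[OF g below_in_max_meets[OF t] vars]
      act_below[OF g tP] ..
  also have "\<dots> = {rename_poly (\<phi> g) (max_part P q t)}"
    using act_vars[OF g _ vars] act_below[OF g tP]
    by (intro SR_coset_below maximals_carrier[OF gt]) (auto simp: below_def)
  finally show ?thesis .
qed

text \<open>Both components at \<open>\<aa>\<close> are computed from a single polynomial, that of q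
  at the translate u of t, which lies above the translate \<open>\<bb>\<close> of the ideal. In this
  way equivariance, a condition at maximal elements, gives invariance at every component.\<close>

lemma SR_action_eq:
  assumes q: "q \<in> carrier (SR_ring k P)" and eqv: "equivariant (max_part P q)" and g: "g \<in> carrier G"
  shows "SR_action k G P \<phi> g q = q"
proof (rule extensionalityI)
  show "SR_action k G P \<phi> g q \<in> extensional (max_meets P)" "q \<in> extensional (max_meets P)"
    using q by (auto simp: SR_ring_def PiE_def SR_action_def)
  fix \<aa> assume a: "\<aa> \<in> max_meets P"
  then obtain t where t: "t \<in> maximals P" "\<aa> \<subseteq> below P t" by (rule max_meets_below)
  note ig = G.inv_closed[OF g] and I = local_ideal_max_meets[OF a] and tP = maximals_carrier[OF t(1)]
  define \<bb> where "\<bb> = \<phi> (inv\<^bsub>G\<^esub> g) ` \<aa>"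
  define u where "u = \<phi> (inv\<^bsub>G\<^esub> g) t"
  define p where "p = max_part P q u"
  have b: "\<bb> \<in> max_meets P" unfolding \<bb>_def by (rule act_max_meets[OF ig a])
  have u: "u \<in> maximals P" unfolding u_def by (rule act_maximals[OF ig t(1)])
  have bu: "\<bb> \<subseteq> below P u"
    unfolding \<bb>_def u_def act_below[OF ig tP, symmetric] using t(2) by blast
  have gb: "\<phi> g ` \<bb> = \<aa>"
    unfolding \<bb>_def by (rule act_image_inv[OF g local_ideal_carrier[OF I]])
  note Ib = local_ideal_max_meets[OF b]
  have p: "poly_vars p \<subseteq> atoms P \<inter> below P u"
    unfolding p_def by (rule poly_vars_max_part[OF q u])
  have pP: "poly_vars p \<subseteq> carrier P" using p by (auto simp: below_def)
  have res: "poly_vars (restrict_poly \<bb> p) \<subseteq> atoms P \<inter> \<bb>"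
    using poly_vars_restrict_poly[of \<bb> p] p by blast
  have max_t: "max_part P q t = rename_poly (\<phi> g) p"
    using eqv g u tP unfolding equivariant_def p_def u_def by (metis act_inv(2))
  have "SR_action k G P \<phi> g q \<aa> = SR_omega k P \<phi> g \<bb> (q \<bb>)"
    using a by (simp add: SR_action_def \<bb>_def)
  also have "\<dots> = SR_coset k P \<aa> (rename_poly (\<phi> g) (restrict_poly \<bb> p))"
    unfolding SR_ring_eq_max_part[OF q u b bu] p_def[symmetric] SR_omega_coset[OF g b res] gb ..
  \<comment> \<open>Truncating to \<open>\<bb>\<close> and renaming is compared with renaming and
    truncating to the translate of \<open>\<bb>\<close>, which is \<open>\<aa>\<close>. In the local
    ring only face monomials count, and these are renamed face monomials of
    \<open>\<bb>\<close>.\<close>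
  also have "\<dots> = SR_coset k P \<aa> (restrict_poly \<aa> (rename_poly (\<phi> g) p))"
  proof (subst SR_coset_eq_iff[OF I], goal_cases)
    case 1
    show ?case using act_vars[OF g local_ideal_carrier[OF Ib] res] gb by simp
  next
    case 2
    show ?case
      using poly_vars_restrict_poly[of \<aa> "max_part P q t"] poly_vars_max_part[OF q t(1)]
      unfolding max_t by blast
  next
    case 3
    show ?case
    proof (intro allI impI)
      fix m :: "'p \<Rightarrow>\<^sub>0 nat" assume m: "Poly_Mapping.keys m \<in> face_sets P \<aa>"
      then obtain n where n: "m = rename_monom (\<phi> g) n" "Poly_Mapping.keys n \<in> face_sets P \<bb>"
        using act_face_monomE[OF g Ib] gb by metis
      have "Poly_Mapping.keys n \<subseteq> \<bb>" "Poly_Mapping.keys m \<subseteq> \<aa>"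
        using face_sets_subset[OF Ib n(2)] face_sets_subset[OF I m] by auto
      moreover have resP: "poly_vars (restrict_poly \<bb> p) \<subseteq> carrier P"
        using res local_ideal_carrier[OF Ib] by blast
      ultimately show "Poly_Mapping.lookup (rename_poly (\<phi> g) (restrict_poly \<bb> p)) m =
          Poly_Mapping.lookup (restrict_poly \<aa> (rename_poly (\<phi> g) p)) m"
        using lookup_rename_act[OF g Ib resP n(2)] lookup_rename_act[OF g Ib pP n(2)] n(1)
        by (simp add: lookup_restrict_poly)
    qed
  qed
  also have "\<dots> = q \<aa>"
    unfolding SR_ring_eq_max_part[OF q t(1) a t(2)] max_t ..
  finally show "SR_action k G P \<phi> g q \<aa> = q \<aa>" .
qed

lemma SR_invariant_iff:
  assumes q: "q \<in> carrier (SR_ring k P)"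
  shows "(\<forall>g\<in>carrier G. SR_action k G P \<phi> g q = q) \<longleftrightarrow> equivariant (max_part P q)"
proof
  assume inv: "\<forall>g\<in>carrier G. SR_action k G P \<phi> g q = q"
  show "equivariant (max_part P q)"
    unfolding equivariant_def
  proof (intro ballI)
    fix g t assume g: "g \<in> carrier G" and t: "t \<in> maximals P"
    note gt = act_maximals[OF g t]
    have "q (below P (\<phi> g t)) = {max_part P q (\<phi> g t)}"
      using max_part_below[OF q gt] SR_coset_below[OF maximals_carrier[OF gt] poly_vars_max_part[OF q gt]]
      by simp
    then show "max_part P q (\<phi> g t) = rename_poly (\<phi> g) (max_part P q t)"
      using SR_action_below[OF q g t] inv g by simp
  qed
qed (use SR_action_eq[OF q] in blast)

section \<open>From equivariant families to families on the orbit poset\<close>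

definition quot_family :: "('p \<Rightarrow> ('p, 'k::field) mpoly) \<Rightarrow> 'p set \<Rightarrow> ('p set, 'k) mpoly" where
  "quot_family f = (\<lambda>T\<in>maximals Q. rename_poly orb (f (SOME t. t \<in> maximals P \<and> orb t = T)))"

text \<open>Two maximal representatives of an orbit differ by some g, and renaming by
  \<open>\<phi> g\<close> becomes invisible after renaming by \<open>orb\<close>.\<close>

lemma quot_family_eq:
  assumes f: "f \<in> max_families k P" "equivariant f" and t: "t \<in> maximals P"
  shows "quot_family f (orb t) = rename_poly orb (f t)"
proof -
  let ?u = "SOME u. u \<in> maximals P \<and> orb u = orb t"
  have u: "?u \<in> maximals P \<and> orb ?u = orb t" by (rule someI[of _ t]) (use t in simp)
  then obtain g where g: "g \<in> carrier G" "\<phi> g t = ?u"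
    using orb_eq_iff[of t ?u] t maximals_carrier[of _ P] by auto
  have "rename_poly orb (f ?u) = rename_poly orb (rename_poly (\<phi> g) (f t))"
    using f(2) g t unfolding equivariant_def by metis
  also have "\<dots> = rename_poly orb (f t)"
    unfolding rename_poly_compose
    by (rule rename_poly_cong)
      (use max_families_poly_vars[OF f(1) t] g(1) orb_act in \<open>auto simp: below_def\<close>)
  finally show ?thesis
    using t by (simp add: quot_family_def maximals_Q)
qed

lemma lookup_rename_orb:
  assumes "t \<in> carrier P" "poly_vars p \<subseteq> atoms P \<inter> below P t" "Poly_Mapping.keys m \<subseteq> atoms P \<inter> below P t"
  shows "Poly_Mapping.lookup (rename_poly orb p) (rename_monom orb m) = Poly_Mapping.lookup p m"
  by (rule lookup_rename_poly[OF inj_on_orb_below[OF assms(1)]]) (use assms(2,3) in auto)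

lemma orb_image_atoms_below:
  assumes "t \<in> carrier P"
  shows "orb ` (atoms P \<inter> below P t) = atoms Q \<inter> below Q (orb t)"
  unfolding below_Q[OF assms] using atoms_Q_iff by (auto simp: below_def)

text \<open>Each orbit in the support of M is replaced by its representative below x, which is
  unique; hence the inverse of \<open>orb\<close> is taken on the atoms below x.\<close>

lemma orb_face_monomE:
  assumes "x \<in> carrier P" "Poly_Mapping.keys M = {V \<in> atoms Q. V \<sqsubseteq>\<^bsub>Q\<^esub> orb x}"
  obtains m where "M = rename_monom orb m" "Poly_Mapping.keys m = {v \<in> atoms P. v \<sqsubseteq>\<^bsub>P\<^esub> x}"
proof -
  let ?A = "{v \<in> atoms P. v \<sqsubseteq>\<^bsub>P\<^esub> x}"
  let ?m = "rename_monom (inv_into ?A orb) M"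
  have M: "Poly_Mapping.keys M = orb ` ?A" using assms atoms_below_Q by simp
  have inj: "inj_on orb ?A"
    by (rule inj_on_subset[OF inj_on_orb_below[OF assms(1)]]) (auto simp: below_def atoms_carrier)
  show thesis
  proof (rule that[of ?m])
    show "M = rename_monom orb ?m"
      unfolding rename_monom_compose
      by (rule rename_monom_id[symmetric]) (simp add: M f_inv_into_f)
    show "Poly_Mapping.keys ?m = ?A"
      unfolding keys_rename_monom M using inj by simp
  qed
qed

lemma atoms_below_subset:
  assumes "x \<in> below P t" "t \<in> carrier P"
  shows "{v \<in> atoms P. v \<sqsubseteq>\<^bsub>P\<^esub> x} \<subseteq> atoms P \<inter> below P t"
  using below_mono[OF assms] atoms_carrier[of _ P] by (auto simp: below_def)

text \<open>For a common lower bound X of T and U, one representative x of X is fixed, and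
  representatives of T and U are then chosen above it. The required equality becomes the
  compatibility of f at x.\<close>

lemma quot_family_in:
  assumes f: "f \<in> max_families k P" "equivariant f"
  shows "quot_family f \<in> max_families k Q"
  unfolding max_families_def
proof (intro CollectI conjI ballI allI impI)
  fix T assume "T \<in> maximals Q"
  then obtain t where t: "t \<in> maximals P" "T = orb t" by (auto simp: maximals_Q)
  show "poly_vars (quot_family f T) \<subseteq> atoms Q \<inter> below Q T"
    unfolding t(2) quot_family_eq[OF f t(1)] orb_image_atoms_below[OF maximals_carrier[OF t(1)], symmetric]
    using poly_vars_rename_poly[of orb "f t"] max_families_poly_vars[OF f(1) t(1)] by blast
next
  fix T U X and M :: "'p set \<Rightarrow>\<^sub>0 nat"
  assume T: "T \<in> maximals Q" and U: "U \<in> maximals Q" and X: "X \<in> below Q T \<inter> below Q U"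
    and M: "Poly_Mapping.keys M = {V \<in> atoms Q. V \<sqsubseteq>\<^bsub>Q\<^esub> X}"
  \<comment> \<open>A representative s with gx below s is replaced by its translate under the
    inverse of g, which has the same orbit and lies above x.\<close>
  have lift: "\<exists>s\<in>maximals P. orb s = S \<and> x \<in> below P s"
    if S: "S \<in> maximals Q" "orb x \<in> below Q S" and x: "x \<in> carrier P" for S x
  proof -
    obtain s where s: "s \<in> maximals P" "S = orb s" using S(1) by (auto simp: maximals_Q)
    obtain g where g: "g \<in> carrier G" "\<phi> g x \<sqsubseteq>\<^bsub>P\<^esub> s"
      using S(2) s x le_Q_iff maximals_carrier[OF s(1)] by (auto simp: below_def)
    then show ?thesis
      using s x maximals_carrier[OF s(1)]
      by (intro bexI[of _ "\<phi> (inv\<^bsub>G\<^esub> g) s"])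
        (simp_all add: orb_act below_def act_le_shift act_maximals)
  qed
  obtain x where x: "x \<in> carrier P" "X = orb x" using X by (auto simp: below_def carrier_Q)
  obtain t where t: "t \<in> maximals P" "orb t = T" "x \<in> below P t" using lift[of T x] T X x by auto
  obtain u where u: "u \<in> maximals P" "orb u = U" "x \<in> below P u" using lift[of U x] U X x by auto
  obtain m where m: "M = rename_monom orb m" "Poly_Mapping.keys m = {v \<in> atoms P. v \<sqsubseteq>\<^bsub>P\<^esub> x}"
    using orb_face_monomE[OF x(1)] M x(2) by metis
  have look: "Poly_Mapping.lookup (quot_family f (orb s)) M = Poly_Mapping.lookup (f s) m"
    if "s \<in> maximals P" "x \<in> below P s" for s
    unfolding quot_family_eq[OF f that(1)] m(1)
    by (rule lookup_rename_orb[OF maximals_carrier[OF that(1)] max_families_poly_vars[OF f(1) that(1)]])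
      (use m(2) atoms_below_subset[OF that(2) maximals_carrier[OF that(1)]] in simp)
  have "Poly_Mapping.lookup (f t) m = Poly_Mapping.lookup (f u) m"
    by (rule max_families_compat[OF f(1) t(1) u(1), of "below P t \<inter> below P u"])
      (use t(3) u(3) m(2) in \<open>auto simp: face_sets_def\<close>)
  then show "Poly_Mapping.lookup (quot_family f T) M = Poly_Mapping.lookup (quot_family f U) M"
    using look[OF t(1,3)] look[OF u(1,3)] t(2) u(2) by simp
qed (simp add: quot_family_def)

lemma inj_on_rename_orb:
  assumes "t \<in> maximals P"
  shows "inj_on (rename_poly orb) {p. poly_vars p \<subseteq> atoms P \<inter> below P t}"
  by (rule inj_on_rename_poly, rule inj_on_subset[OF inj_on_orb_below[OF maximals_carrier[OF assms]]]) auto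

text \<open>Since \<open>orb\<close> is injective on the interval of t, the polynomial at t can be
  recovered from its renaming, the value of \<open>quot_family\<close> at
  \<open>orb t\<close>.\<close>

lemma inj_on_quot_family: "inj_on quot_family {f \<in> max_families k P. equivariant f}"
proof (rule inj_onI)
  fix e f assume "e \<in> {f \<in> max_families k P. equivariant f}" "f \<in> {f \<in> max_families k P. equivariant f}"
    and eq: "quot_family e = quot_family f"
  then have e: "e \<in> max_families k P" "equivariant e" and f: "f \<in> max_families k P" "equivariant f"
    by auto
  show "e = f"
  proof (rule extensionalityI)
    show "e \<in> extensional (maximals P)" "f \<in> extensional (maximals P)"
      using e(1) f(1) by (simp_all add: max_families_def)
    fix t assume t: "t \<in> maximals P"
    show "e t = f t"
      by (rule inj_onD[OF inj_on_rename_orb[OF t]])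
        (use quot_family_eq[OF e t] quot_family_eq[OF f t] eq max_families_poly_vars[OF e(1) t]
          max_families_poly_vars[OF f(1) t] in simp_all)
  qed
qed

text \<open>A family on P/G is pulled back interval by interval with the local inverse of the orbit
  map. The resulting f is controlled by \<open>ren\<close>: renaming by \<open>orb\<close> is
  injective on polynomials in the atoms below t, so compatibility and equivariance can be checked
  after it.\<close>

lemma quot_family_surj:
  assumes F: "F \<in> max_families k Q"
  shows "\<exists>f\<in>max_families k P. equivariant f \<and> quot_family f = F"
proof -
  define f where "f = (\<lambda>t\<in>maximals P. rename_poly (inv_into (atoms P \<inter> below P t) orb) (F (orb t)))"
  have Fv: "poly_vars (F (orb t)) \<subseteq> orb ` (atoms P \<inter> below P t)" if "t \<in> maximals P" for t
    unfolding orb_image_atoms_below[OF maximals_carrier[OF that]]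
    using that by (intro Q.max_families_poly_vars[OF F]) (simp add: maximals_Q)
  have vars: "poly_vars (f t) \<subseteq> atoms P \<inter> below P t" if t: "t \<in> maximals P" for t
  proof -
    let ?h = "inv_into (atoms P \<inter> below P t) orb"
    have "poly_vars (f t) \<subseteq> ?h ` poly_vars (F (orb t))"
      using t poly_vars_rename_poly[of ?h "F (orb t)"] by (simp add: f_def)
    also have "\<dots> \<subseteq> atoms P \<inter> below P t"
    proof (rule image_subsetI)
      fix V assume "V \<in> poly_vars (F (orb t))"
      then have "V \<in> orb ` (atoms P \<inter> below P t)" by (rule subsetD[OF Fv[OF t]])
      then show "?h V \<in> atoms P \<inter> below P t" by (rule inv_into_into)
    qed
    finally show ?thesis .
  qed
  have ren: "rename_poly orb (f t) = F (orb t)" if t: "t \<in> maximals P" for t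
  proof -
    have "rename_poly orb (f t) =
        rename_poly (\<lambda>V. orb (inv_into (atoms P \<inter> below P t) orb V)) (F (orb t))"
      using t by (simp add: f_def rename_poly_compose)
    also have "\<dots> = F (orb t)"
    proof (rule rename_poly_id)
      fix V assume "V \<in> poly_vars (F (orb t))"
      then have "V \<in> orb ` (atoms P \<inter> below P t)" by (rule subsetD[OF Fv[OF t]])
      then show "orb (inv_into (atoms P \<inter> below P t) orb V) = V" by (rule f_inv_into_f)
    qed
    finally show ?thesis .
  qed
  have look: "Poly_Mapping.lookup (f t) m = Poly_Mapping.lookup (F (orb t)) (rename_monom orb m)"
    if t: "t \<in> maximals P" and x: "x \<in> below P t"
      and m: "Poly_Mapping.keys m = {v \<in> atoms P. v \<sqsubseteq>\<^bsub>P\<^esub> x}" for t x m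
    unfolding ren[OF t, symmetric]
    by (rule lookup_rename_orb[OF maximals_carrier[OF t] vars[OF t], symmetric])
      (use m atoms_below_subset[OF x maximals_carrier[OF t]] in simp)
  have fam: "f \<in> max_families k P"
    unfolding max_families_def
  proof (intro CollectI conjI ballI allI impI vars)
    fix t u x and m :: "'p \<Rightarrow>\<^sub>0 nat"
    assume t: "t \<in> maximals P" and u: "u \<in> maximals P" and x: "x \<in> below P t \<inter> below P u"
      and m: "Poly_Mapping.keys m = {v \<in> atoms P. v \<sqsubseteq>\<^bsub>P\<^esub> x}"
    have xP: "x \<in> carrier P" using x by (simp add: below_def)
    have face: "Poly_Mapping.keys (rename_monom orb m) \<in> face_sets Q (below Q (orb t) \<inter> below Q (orb u))"
      using x m atoms_below_Q[OF xP] below_Q maximals_carrier[OF t] maximals_carrier[OF u]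
      by (auto simp: face_sets_def keys_rename_monom intro!: exI[of _ "orb x"])
    have "Poly_Mapping.lookup (F (orb t)) (rename_monom orb m) =
        Poly_Mapping.lookup (F (orb u)) (rename_monom orb m)"
      by (rule Q.max_families_compat[OF F _ _ Int_lower1 Int_lower2 face])
        (use t u in \<open>simp_all add: maximals_Q\<close>)
    then show "Poly_Mapping.lookup (f t) m = Poly_Mapping.lookup (f u) m"
      using look[OF t _ m] look[OF u _ m] x by simp
  qed (simp add: f_def)
  moreover have eqv: "equivariant f"
    unfolding equivariant_def
  proof (intro ballI)
    fix g t assume g: "g \<in> carrier G" and t: "t \<in> maximals P"
    note gt = act_maximals[OF g t] and tP = maximals_carrier[OF t]
    have v: "poly_vars (rename_poly (\<phi> g) (f t)) \<subseteq> atoms P \<inter> below P (\<phi> g t)"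
      using act_vars[OF g _ vars[OF t]] act_below[OF g tP] by (auto simp: below_def)
    \<comment> \<open>The two polynomials to be compared have their variables among the atoms below
      gt, so it suffices that they agree after renaming by \<open>orb\<close>.\<close>
    have "rename_poly orb (rename_poly (\<phi> g) (f t)) = rename_poly orb (f t)"
      unfolding rename_poly_compose
      by (rule rename_poly_cong) (use vars[OF t] g orb_act in \<open>auto simp: below_def\<close>)
    also have "\<dots> = rename_poly orb (f (\<phi> g t))"
      using ren[OF t] ren[OF gt] orb_act[OF g tP] by simp
    finally show "f (\<phi> g t) = rename_poly (\<phi> g) (f t)"
      by (intro inj_onD[OF inj_on_rename_orb[OF gt]]) (use v vars[OF gt] in simp_all)
  qed
  moreover have "quot_family f = F"
  proof (rule extensionalityI)
    show "quot_family f \<in> extensional (maximals Q)" "F \<in> extensional (maximals Q)"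
      using F by (simp_all add: quot_family_def max_families_def)
    fix T assume "T \<in> maximals Q"
    then obtain t where "t \<in> maximals P" "T = orb t" by (auto simp: maximals_Q)
    then show "quot_family f T = F T" using quot_family_eq[OF fam eqv] ren by simp
  qed
  ultimately show ?thesis by blast
qed

lemma bij_betw_quot_family:
  "bij_betw quot_family {f \<in> max_families k P. equivariant f} (max_families k Q)"
  unfolding bij_betw_def
proof (intro conjI inj_on_quot_family equalityI subsetI)
  fix F assume "F \<in> max_families k Q"
  then show "F \<in> quot_family ` {f \<in> max_families k P. equivariant f}"
    using quot_family_surj by blast
qed (use quot_family_in in auto)

lemma carrier_SR_invariant_ring:
  "carrier (SR_invariant_ring k G P \<phi>) = {q \<in> carrier (SR_ring k P). equivariant (max_part P q)}"
  using SR_invariant_iff by (auto simp: SR_invariant_ring_def)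

lemma bij_betw_max_part_invariants:
  "bij_betw (max_part P) (carrier (SR_invariant_ring k G P \<phi>)) {f \<in> max_families k P. equivariant f}"
proof -
  have "bij_betw (max_part P) (carrier (SR_invariant_ring k G P \<phi>))
      (max_part P ` carrier (SR_invariant_ring k G P \<phi>))"
    by (rule bij_betw_imageI[OF inj_on_subset[OF inj_on_max_part] refl])
      (auto simp: carrier_SR_invariant_ring)
  also have "max_part P ` carrier (SR_invariant_ring k G P \<phi>) = {f \<in> max_families k P. equivariant f}"
    unfolding carrier_SR_invariant_ring bij_betw_imp_surj_on[OF bij_betw_max_part[of k], symmetric] by blast
  finally show ?thesis .
qed

lemma SR_invariant_ring_iso: "quot_family \<circ> max_part P \<in> ring_iso (SR_invariant_ring k G P \<phi>) (max_ring k Q)"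
proof (rule ring_iso_memI)
  show bij: "bij_betw (quot_family \<circ> max_part P) (carrier (SR_invariant_ring k G P \<phi>)) (carrier (max_ring k Q))"
    using bij_betw_trans[OF bij_betw_max_part_invariants bij_betw_quot_family] by (simp add: max_ring_def)
  then show "(quot_family \<circ> max_part P) q \<in> carrier (max_ring k Q)"
    if "q \<in> carrier (SR_invariant_ring k G P \<phi>)" for q
    using that by (rule bij_betwE[rule_format])
  have some: "(SOME t. t \<in> maximals P \<and> orb t = T) \<in> maximals P" if "T \<in> maximals Q" for T
    using that someI_ex[of "\<lambda>t. t \<in> maximals P \<and> orb t = T"] by (auto simp: maximals_Q)
  \<comment> \<open>The representative chosen for T does not depend on the family, so
    \<open>quot_family\<close> respects the operations componentwise.\<close>
  have ops: "quot_family (f \<otimes>\<^bsub>max_ring k P\<^esub> g) = quot_family f \<otimes>\<^bsub>max_ring k Q\<^esub> quot_family g"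
    "quot_family (f \<oplus>\<^bsub>max_ring k P\<^esub> g) = quot_family f \<oplus>\<^bsub>max_ring k Q\<^esub> quot_family g"
    "quot_family \<one>\<^bsub>max_ring k P\<^esub> = \<one>\<^bsub>max_ring k Q\<^esub>" for f g
    by (auto simp: quot_family_def max_ring_def some rename_poly_mult rename_poly_add rename_poly_one
        intro!: restrict_ext)
  have same: "x \<otimes>\<^bsub>SR_invariant_ring k G P \<phi>\<^esub> y = x \<otimes>\<^bsub>SR_ring k P\<^esub> y"
    "x \<oplus>\<^bsub>SR_invariant_ring k G P \<phi>\<^esub> y = x \<oplus>\<^bsub>SR_ring k P\<^esub> y"
    "\<one>\<^bsub>SR_invariant_ring k G P \<phi>\<^esub> = \<one>\<^bsub>SR_ring k P\<^esub>" for x y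
    by (simp_all add: SR_invariant_ring_def)
  show "(quot_family \<circ> max_part P) \<one>\<^bsub>SR_invariant_ring k G P \<phi>\<^esub> = \<one>\<^bsub>max_ring k Q\<^esub>"
    by (simp add: same ops max_part_one)
  fix x y assume "x \<in> carrier (SR_invariant_ring k G P \<phi>)" "y \<in> carrier (SR_invariant_ring k G P \<phi>)"
  then have xy: "x \<in> carrier (SR_ring k P)" "y \<in> carrier (SR_ring k P)"
    by (simp_all add: carrier_SR_invariant_ring)
  show "(quot_family \<circ> max_part P) (x \<otimes>\<^bsub>SR_invariant_ring k G P \<phi>\<^esub> y) =
      (quot_family \<circ> max_part P) x \<otimes>\<^bsub>max_ring k Q\<^esub> (quot_family \<circ> max_part P) y"
    by (simp add: same ops max_part_ops[OF xy])
  show "(quot_family \<circ> max_part P) (x \<oplus>\<^bsub>SR_invariant_ring k G P \<phi>\<^esub> y) =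
      (quot_family \<circ> max_part P) x \<oplus>\<^bsub>max_ring k Q\<^esub> (quot_family \<circ> max_part P) y"
    by (simp add: same ops max_part_ops[OF xy])
qed

end

text \<open>Membership in \<open>ring_iso\<close> says nothing about closure of the carriers.
  Closure of S is what lets \<open>?h\<close> cancel g on sums, products and the unit, so that the
  inverse of g is again multiplicative and additive.\<close>

lemma ring_iso_through:
  assumes f: "f \<in> ring_iso R T" and g: "g \<in> ring_iso S T"
    and closed: "\<And>x y. \<lbrakk>x \<in> carrier S; y \<in> carrier S\<rbrakk> \<Longrightarrow> x \<otimes>\<^bsub>S\<^esub> y \<in> carrier S"
      "\<And>x y. \<lbrakk>x \<in> carrier S; y \<in> carrier S\<rbrakk> \<Longrightarrow> x \<oplus>\<^bsub>S\<^esub> y \<in> carrier S" "\<one>\<^bsub>S\<^esub> \<in> carrier S"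
  shows "R \<simeq> S"
proof -
  let ?h = "inv_into (carrier S) g"
  note bf = ring_iso_memE(5)[OF f] and bg = ring_iso_memE(5)[OF g]
  have fR: "f x \<in> carrier T" if "x \<in> carrier R" for x
    using bf that by (auto simp: bij_betw_def)
  have hg: "?h (g y) = y" if "y \<in> carrier S" for y
    using bg that by (simp add: bij_betw_inv_into_left)
  have gh: "g (?h z) = z" "?h z \<in> carrier S" if "z \<in> carrier T" for z
    using bg that by (simp_all add: bij_betw_inv_into_right bij_betwE[OF bij_betw_inv_into])
  have "?h \<circ> f \<in> ring_iso R S"
  proof (rule ring_iso_memI)
    show "(?h \<circ> f) x \<in> carrier S" if "x \<in> carrier R" for x
      using gh(2) fR that by simp
    show "bij_betw (?h \<circ> f) (carrier R) (carrier S)"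
      using bf bij_betw_inv_into[OF bg] by (rule bij_betw_trans)
    show "(?h \<circ> f) \<one>\<^bsub>R\<^esub> = \<one>\<^bsub>S\<^esub>"
      using hg[OF closed(3)] ring_iso_memE(4)[OF f] ring_iso_memE(4)[OF g] by simp
    fix x y assume xy: "x \<in> carrier R" "y \<in> carrier R"
    let ?x = "?h (f x)" and ?y = "?h (f y)"
    have "f (x \<otimes>\<^bsub>R\<^esub> y) = g (?x \<otimes>\<^bsub>S\<^esub> ?y)"
      using xy fR gh ring_iso_memE(2)[OF f] ring_iso_memE(2)[OF g] by simp
    then show "(?h \<circ> f) (x \<otimes>\<^bsub>R\<^esub> y) = (?h \<circ> f) x \<otimes>\<^bsub>S\<^esub> (?h \<circ> f) y"
      using hg[OF closed(1)] gh(2) fR xy by simp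
    have "f (x \<oplus>\<^bsub>R\<^esub> y) = g (?x \<oplus>\<^bsub>S\<^esub> ?y)"
      using xy fR gh ring_iso_memE(3)[OF f] ring_iso_memE(3)[OF g] by simp
    then show "(?h \<circ> f) (x \<oplus>\<^bsub>R\<^esub> y) = (?h \<circ> f) x \<oplus>\<^bsub>S\<^esub> (?h \<circ> f) y"
      using hg[OF closed(2)] gh(2) fR xy by simp
  qed
  then show ?thesis by (auto simp: is_ring_iso_def)
qed

theorem theorem2:
  fixes k :: "'k::field itself"
    and G :: "('g, 'n) monoid_scheme"
    and P :: "('p, 'm) gorder_scheme"
    and \<phi> :: "'g \<Rightarrow> 'p \<Rightarrow> 'p"
  assumes "group G"
    and "simplicial_poset P"
    and "poset_action G P \<phi>"
    and "translative G P \<phi>"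
  shows "SR_invariant_ring k G P \<phi> \<simeq> SR_ring k (quotient_poset G P \<phi>)"
proof -
  interpret translative_action P G \<phi>
    using assms by (simp add: translative_action_def translative_action_axioms_def simplicial_def)
  show ?thesis
    by (rule ring_iso_through[OF SR_invariant_ring_iso Q.max_part_ring_iso
          Q.SR_ring_closed Q.SR_ring_one_closed])
qed

end
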